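(* Let $a,r\in\mathbb N$. Then $\mathcal A_{a,2r,r}$, viewed as a function of $\tau$ in the upper half-plane via $q=e^{2\pi i\tau}$, is a quasimodular form of (mixed) weight $2ar$ on $\mathrm{SL}_2(\mathbb Z)$, i.e. it is a finite sum of quasimodular forms on $\mathrm{SL}_2(\mathbb Z)$ of weights at most $2ar$ (equivalently, a polynomial in $E_2,E_4,E_6$ of weighted degree at most $2ar$, where $E_j$ has weight $j$).
   Context: For $a,r\in\mathbb N$ and $k\in\mathbb Z$, $\mathcal A_{a,k,r}(q):=\sum_{1\le n_1<\dots<n_a}\frac{q^{r(n_1+\dots+n_a)}}{(1-q^{n_1})^k\cdots(1-q^{n_a})^k}$. For even $k\ge2$, $E_k(\tau):=1-\frac{2k}{B_k}\sum_{n\ge1}\sigma_{k-1}(n)q^n$ with $B_k$ the Bernoulli numbers and $\sigma_{k-1}(n)=\sum_{d\mid n}d^{k-1}$. Quasimodular forms on $\mathrm{SL}_2(\mathbb Z)$ of weight $w$ are the weight-$w$ homogeneous polynomials in $E_2,E_4,E_6$. *)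

theory Defs
  imports "HOL-Analysis.Analysis"
begin

text \<open>
  The series \<open>\<A>\<^bsub>a,k,r\<^esub>(q)\<close>. An index \<open>1 \<le> n\<^sub>1 < \<dots> < n\<^sub>a\<close> is encoded as a strictly
  increasing list of length \<open>a\<close>. The sum is unconditional; it converges for \<open>\<bar>q\<bar> < 1\<close>
  and \<open>r \<ge> 1\<close>, but for \<open>a \<ge> 1\<close>, \<open>r = 0\<close> its terms need not tend to \<open>0\<close>.
\<close>

definition index_tuples :: "nat \<Rightarrow> nat list set" where
  "index_tuples a = {ns. length ns = a \<and> sorted_wrt (<) ns \<and> (\<forall>n\<in>set ns. 1 \<le> n)}"

definition A_series :: "nat \<Rightarrow> int \<Rightarrow> nat \<Rightarrow> complex \<Rightarrow> complex" where
  "A_series a k r q =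
     (\<Sum>\<^sub>\<infinity>ns\<in>index_tuples a. q ^ (r * sum_list ns) / (\<Prod>n\<leftarrow>ns. (1 - q ^ n) powi k))"

text \<open>Bernoulli numbers, via \<open>\<Sum>\<^bsub>k \<le> n\<^esub> (n+1 choose k) B\<^sub>k = 0\<close> for \<open>n \<ge> 1\<close>.\<close>

fun bernoulli :: "nat \<Rightarrow> real" where
  "bernoulli n =
     (if n = 0 then 1
      else - (\<Sum>k<n. real (Suc n choose k) * bernoulli k) / real (Suc n))"

declare bernoulli.simps [simp del]

lemma bernoulli_2: "bernoulli 2 = 1 / 6"
  and bernoulli_4: "bernoulli 4 = - 1 / 30"
  and bernoulli_6: "bernoulli 6 = 1 / 42"
proof -
  have b0: "bernoulli 0 = 1"
    by (simp add: bernoulli.simps)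
  have b1: "bernoulli (Suc 0) = - 1 / 2"
    by (subst bernoulli.simps) (simp add: b0)
  show b2: "bernoulli 2 = 1 / 6"
    by (subst bernoulli.simps) (simp add: b0 b1 numeral_eq_Suc)
  have b3: "bernoulli 3 = 0"
    using b2 by (subst bernoulli.simps) (simp add: b0 b1 numeral_eq_Suc)
  show b4: "bernoulli 4 = - 1 / 30"
    using b2 b3 by (subst bernoulli.simps) (simp add: b0 b1 numeral_eq_Suc)
  have b5: "bernoulli 5 = 0"
    using b2 b3 b4 by (subst bernoulli.simps) (simp add: b0 b1 numeral_eq_Suc)
  show "bernoulli 6 = 1 / 42"
    using b2 b3 b4 b5 by (subst bernoulli.simps) (simp add: b0 b1 numeral_eq_Suc)
qed

definition divisor_sigma :: "nat \<Rightarrow> nat \<Rightarrow> nat" where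
  "divisor_sigma m n = (\<Sum>d | d dvd n. d ^ m)"

definition nome :: "complex \<Rightarrow> complex" where
  "nome \<tau> = exp (2 * of_real pi * \<i> * \<tau>)"

text \<open>Used for even \<open>k \<ge> 2\<close> and \<open>Im \<tau> > 0\<close> only.\<close>

definition Eisenstein_E :: "nat \<Rightarrow> complex \<Rightarrow> complex" where
  "Eisenstein_E k \<tau> =
     1 - of_real (2 * real k / bernoulli k) *
         (\<Sum>n. of_nat (divisor_sigma (k - 1) (Suc n)) * nome \<tau> ^ Suc n)"

text \<open>
  A form is a function on the upper half-plane, so only its values there matter. The triple
  \<open>(i, j, l)\<close> is the exponent of the monomial \<open>E\<^sub>2\<^sup>i E\<^sub>4\<^sup>j E\<^sub>6\<^sup>l\<close>.
\<close>

definition weight_exponents :: "nat \<Rightarrow> (nat \<times> nat \<times> nat) set" where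
  "weight_exponents w = {(i, j, l). 2 * i + 4 * j + 6 * l = w}"

lemma finite_weight_exponents: "finite (weight_exponents w)"
  by (rule finite_subset[of _ "{..w} \<times> {..w} \<times> {..w}"]) (auto simp: weight_exponents_def)

definition quasimodular_form :: "nat \<Rightarrow> (complex \<Rightarrow> complex) \<Rightarrow> bool" where
  "quasimodular_form w f \<longleftrightarrow>
     (\<exists>c :: nat \<Rightarrow> nat \<Rightarrow> nat \<Rightarrow> complex. \<forall>\<tau>. Im \<tau> > 0 \<longrightarrow>
        f \<tau> = (\<Sum>(i, j, l)\<in>weight_exponents w.
                 c i j l * Eisenstein_E 2 \<tau> ^ i * Eisenstein_E 4 \<tau> ^ j * Eisenstein_E 6 \<tau> ^ l))"

definition mixed_quasimodular_form :: "nat \<Rightarrow> (complex \<Rightarrow> complex) \<Rightarrow> bool" where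
  "mixed_quasimodular_form W f \<longleftrightarrow>
     (\<exists>(N :: nat) (w :: nat \<Rightarrow> nat) (F :: nat \<Rightarrow> complex \<Rightarrow> complex).
        (\<forall>i<N. w i \<le> W \<and> quasimodular_form (w i) (F i)) \<and>
        (\<forall>\<tau>. Im \<tau> > 0 \<longrightarrow> f \<tau> = (\<Sum>i<N. F i \<tau>)))"

end

theory Submission
  imports Defs
begin

text \<open>
  Let \<open>\<phi>(x) = x / (1 - x)\<^sup>2\<close> and \<open>x\<^sub>n = \<phi>(q\<^sup>n)\<close>. The series is the \<open>a\<close>-th elementary symmetric function
  of the \<open>x\<^sub>n\<^sup>r\<close>, so by Newton's identities it is a polynomial in the power sums
  \<open>P\<^sub>s = \<Sum> x\<^sub>n\<^sup>s\<close>, and it suffices that \<open>P\<^sub>s\<close> has weight at most \<open>2 s\<close>.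

  The function \<open>F(w) = \<Sum>\<phi>(q\<^sup>n w)\<close>, summed over all integers \<open>n\<close>, is a Weierstrass function in multiplicative
  notation. Partial fractions for \<open>\<phi>(x) \<phi>(t x)\<close> and a telescoping sum give
  \<open>F\<^sup>2 = \<Sum>\<phi>(q\<^sup>n w)\<^sup>2 + 4 P\<^sub>1 F + const\<close>. In the coordinate \<open>X = w + 1 / w - 2 = 1 / \<phi>(w)\<close>, both sums are
  \<open>1 / X\<close> and \<open>1 / X\<^sup>2\<close> plus power series in \<open>X\<close> whose coefficients are linear in the \<open>P\<^sub>s\<close>. Comparing coefficients
  expresses each \<open>P\<^sub>s\<close> with \<open>s \<ge> 4\<close> through earlier ones, while \<open>P\<^sub>1\<close>, \<open>P\<^sub>2\<close>, \<open>P\<^sub>3\<close> are linear in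
  \<open>E\<^sub>2\<close>, \<open>E\<^sub>4\<close>, \<open>E\<^sub>6\<close>.
\<close>

section \<open>Sums over a geometric progression\<close>

lemma has_sum_Times_complex:
  fixes f :: "'a \<Rightarrow> complex" and g :: "'b \<Rightarrow> complex"
  assumes "(f has_sum s) A" and "(g has_sum t) B"
  shows "((\<lambda>(x, y). f x * g y) has_sum (s * t)) (A \<times> B)"
proof (rule has_sum_SigmaI)
  show "((\<lambda>y. case (x, y) of (x, y) \<Rightarrow> f x * g y) has_sum f x * t) B" for x
    using has_sum_cmult_right[OF assms(2)] by simp
  show "((\<lambda>x. f x * t) has_sum s * t) A"
    by (rule has_sum_cmult_left[OF assms(1)])
  \<comment> \<open>For complex families summability is absolute summability, and the norms of a
    product family factor.\<close>
  have "(\<lambda>x. norm (f x)) summable_on A" "(\<lambda>y. norm (g y)) summable_on B"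
    using assms by (auto simp: summable_on_iff_abs_summable_on_complex[symmetric]
        dest: has_sum_imp_summable)
  then have "(\<lambda>p. norm (case p of (x, y) \<Rightarrow> f x * g y)) summable_on (A \<times> B)"
    unfolding Infinite_Sum.abs_summable_on_Sigma_iff
    by (auto simp: norm_mult abs_mult infsum_cmult_right' intro!: summable_on_cmult_right summable_on_cmult_left)
  then show "(\<lambda>(x, y). f x * g y) summable_on (A \<times> B)"
    by (simp add: summable_on_iff_abs_summable_on_complex)
qed

lemma summable_on_intI:
  fixes f :: "int \<Rightarrow> complex"
  assumes "(\<lambda>n. f (int n)) summable_on UNIV" and "(\<lambda>n. f (- int (Suc n))) summable_on UNIV"
  shows "f summable_on UNIV"
proof -
  have "f summable_on {0..}"
    by (rule iffD1[OF summable_on_reindex_bij_witness[where i = nat and j = int] assms(1)]) auto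
  moreover have "f summable_on {..<0}"
    by (rule iffD1[OF summable_on_reindex_bij_witness
          [where i = "\<lambda>n. nat (- n - 1)" and j = "\<lambda>n. - int (Suc n)"] assms(2)]) auto
  ultimately have "f summable_on ({0..} \<union> {..<0})"
    by (rule summable_on_Un_disjoint) auto
  also have "{0..} \<union> {..<0} = (UNIV :: int set)"
    by auto
  finally show ?thesis .
qed

text \<open>With \<open>koebe_inverse\<close>, the terms at n and -n become
  \<open>koebe (q ^ n * w)\<close> and \<open>koebe (q ^ n / w)\<close>, a pair symmetric in
  \<open>w\<close> and \<open>1 / w\<close>.\<close>

lemma has_sum_int_fold:
  fixes f :: "int \<Rightarrow> complex"
  assumes "(f has_sum s) UNIV"
  shows "((\<lambda>n. f (int (Suc n)) + f (- int (Suc n))) has_sum (s - f 0)) UNIV"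
proof -
  have summ: "f summable_on A" for A
    using assms summable_on_subset[of f UNIV A] by (auto dest: has_sum_imp_summable)
  obtain a b where a: "(f has_sum a) {1..}" and b: "(f has_sum b) {..<0}"
    using summ unfolding summable_on_def by metis
  have "(f has_sum (f 0 + (a + b))) (insert 0 ({1..} \<union> {..<0}))"
    by (intro has_sum_insert has_sum_Un_disjoint a b) auto
  also have "insert 0 ({1..} \<union> {..<0}) = (UNIV :: int set)"
    by auto
  finally have "s - f 0 = a + b"
    using has_sum_unique[OF assms] by simp
  moreover have "((\<lambda>n. f (int (Suc n))) has_sum a) UNIV"
    by (rule iffD2[OF has_sum_reindex_bij_witness
          [where i = "\<lambda>n. nat (n - 1)" and j = "\<lambda>n. int (Suc n)"] a]) auto
  moreover have "((\<lambda>n. f (- int (Suc n))) has_sum b) UNIV"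
    by (rule iffD2[OF has_sum_reindex_bij_witness
          [where i = "\<lambda>n. nat (- n - 1)" and j = "\<lambda>n. - int (Suc n)"] b]) auto
  ultimately show ?thesis
    by (simp only: has_sum_add)
qed

lemma has_sum_int_shift:
  fixes f :: "int \<Rightarrow> complex"
  assumes "(f has_sum s) UNIV"
  shows "((\<lambda>n. f (n + k)) has_sum s) UNIV"
  by (rule iffD2[OF has_sum_reindex_bij_witness
        [where i = "\<lambda>n. n - k" and j = "\<lambda>n. n + k"] assms]) auto

text \<open>The two step functions differ at exactly |k| integers, always with the same
  sign.\<close>

lemma has_sum_int_step_shift:
  "((\<lambda>n. of_bool (n \<ge> 0) - of_bool (n + k \<ge> 0)) has_sum (- of_int k :: complex)) UNIV"
proof (cases "k \<ge> 0")
  case True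
  have "(\<Sum>n\<in>{-k..<0}. of_bool (n \<ge> 0) - of_bool (n + k \<ge> 0)) = (\<Sum>n\<in>{-k..<0}. - 1 :: complex)"
    by (intro sum.cong) auto
  also have "\<dots> = - of_int k"
    using True by simp
  finally show ?thesis
    by (intro has_sum_finite_neutralI[where B = "{-k..<0}"]) (use True in auto)
next
  case False
  have "(\<Sum>n\<in>{0..<-k}. of_bool (n \<ge> 0) - of_bool (n + k \<ge> 0)) = (\<Sum>n\<in>{0..<-k}. 1 :: complex)"
    by (intro sum.cong) auto
  also have "\<dots> = - of_int k"
    using False by simp
  finally show ?thesis
    by (intro has_sum_finite_neutralI[where B = "{0..<-k}"]) (use False in auto)
qed

text \<open>The points \<open>q ^ n * w\<close> eventually enter the disc of radius 1/2, where the
  linear bound on \<open>g\<close> allows comparison with a geometric series.\<close>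

lemma summable_on_geometric_argument:
  fixes q w :: complex and g :: "complex \<Rightarrow> complex"
  assumes "norm q < 1" and g: "\<And>x. norm x \<le> 1 / 2 \<Longrightarrow> norm (g x) \<le> C * norm x"
  shows "(\<lambda>n. g (q ^ n * w)) summable_on (UNIV :: nat set)"
proof (rule norm_summable_imp_summable_on, rule summable_comparison_test_ev)
  have "(\<lambda>n. q ^ n * w) \<longlonglongrightarrow> 0 * w"
    by (intro tendsto_intros LIMSEQ_power_zero assms)
  then have "eventually (\<lambda>n. norm (q ^ n * w) < 1 / 2) sequentially"
    using tendstoD[of "\<lambda>n. q ^ n * w" 0 sequentially "1 / 2"] by simp
  then show "eventually (\<lambda>n. norm (norm (g (q ^ n * w))) \<le> C * (norm q ^ n * norm w)) sequentially"
  proof eventually_elim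
    case (elim n)
    then show ?case
      using g[of "q ^ n * w"] by (simp add: norm_mult norm_power)
  qed
  show "summable (\<lambda>n. C * (norm q ^ n * norm w))"
    by (intro summable_mult summable_mult2 summable_geometric) (use assms in auto)
qed

section \<open>The function \<phi> and its partial fractions\<close>

definition koebe :: "complex \<Rightarrow> complex" where
  "koebe x = x / (1 - x)\<^sup>2"

text \<open>At the pole 1 the value is 0, because division by zero gives 0. So
  \<open>koebe_sum 1\<close> in effect omits its term at 0.\<close>

lemma koebe_0 [simp]: "koebe 0 = 0" and koebe_1 [simp]: "koebe 1 = 0"
  by (simp_all add: koebe_def)

lemma koebe_inverse [simp]: "koebe (inverse x) = koebe x"
proof (cases "x = 0 \<or> x = 1")
  case False
  then have "1 - inverse x = - (1 - x) / x"
    by (simp add: field_simps)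
  then show ?thesis
    using False by (simp add: koebe_def power2_eq_square divide_simps) (simp add: algebra_simps)
qed auto

lemma half_le_norm_one_minus:
  fixes x :: complex
  assumes "norm x \<le> 1 / 2"
  shows "1 / 2 \<le> norm (1 - x)"
  using norm_triangle_ineq2[of 1 x] assms by simp

lemma norm_koebe_le:
  assumes "norm x \<le> 1 / 2"
  shows "norm (koebe x) \<le> 4 * norm x"
proof -
  have "(1 / 2)\<^sup>2 \<le> (norm (1 - x))\<^sup>2"
    by (intro power_mono half_le_norm_one_minus assms) auto
  then have "1 / (norm (1 - x))\<^sup>2 \<le> 1 / (1 / 4)"
    by (intro divide_left_mono) (auto simp: power2_eq_square)
  then have "norm x * (1 / (norm (1 - x))\<^sup>2) \<le> norm x * 4"
    by (intro mult_left_mono) auto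
  then show ?thesis
    by (simp add: koebe_def norm_divide norm_power)
qed

lemma norm_divide_one_minus_le:
  fixes x :: complex
  assumes "norm x \<le> 1 / 2"
  shows "norm (x / (1 - x)) \<le> 2 * norm x"
proof -
  have "1 / norm (1 - x) \<le> 1 / (1 / 2)"
    using half_le_norm_one_minus[OF assms] by (intro divide_left_mono) auto
  then have "norm x * (1 / norm (1 - x)) \<le> norm x * 2"
    by (intro mult_left_mono) auto
  then show ?thesis
    by (simp add: norm_divide)
qed

text \<open>Partial fractions in \<open>x\<close>. The double poles at 1 and 1 / t share the
  coefficient \<open>koebe t\<close>; what remains is a multiple of a difference that telescopes
  when \<open>x\<close> runs through \<open>q powi n * w\<close> and
  \<open>t = q powi k\<close>.\<close>

lemma koebe_mult_koebe:
  assumes "x \<noteq> 1" and "t * x \<noteq> 1" and "t \<noteq> 1"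
  shows "koebe x * koebe (t * x) = koebe t * (koebe x + koebe (t * x))
           - t * (1 + t) / (1 - t) ^ 3 * (1 / (1 - x) - 1 / (1 - t * x))"
proof -
  have nz: "1 - x \<noteq> 0" "1 - t * x \<noteq> 0" "1 - t \<noteq> 0"
    using assms by auto
  define a b c where "a = 1 - x" and "b = 1 - t * x" and "c = 1 - t"
  have nz': "a \<noteq> 0" "b \<noteq> 0" "c \<noteq> 0"
    using nz by (simp_all add: a_def b_def c_def)
  have "x * (t * x) * c ^ 3 = t * c * (x * b\<^sup>2 + t * x * a\<^sup>2) - t * (1 + t) * (b - a) * (a * b)"
    unfolding a_def b_def c_def by algebra
  then have "x / a\<^sup>2 * (t * x / b\<^sup>2) = t / c\<^sup>2 * (x / a\<^sup>2 + t * x / b\<^sup>2) - t * (1 + t) / c ^ 3 * (1 / a - 1 / b)"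
    using nz' by (simp add: divide_simps power2_eq_square power3_eq_cube) algebra
  then show ?thesis
    by (simp add: koebe_def a_def b_def c_def)
qed

section \<open>Two-sided sums over \<open>q powi n * w\<close>\<close>

locale punctured_disc =
  fixes q :: complex
  assumes q_nonzero: "q \<noteq> 0" and norm_q: "norm q < 1"
begin

lemma q_power_neq_1: "q ^ Suc n \<noteq> 1"
  using norm_q power_Suc_less_one[of "norm q" n] q_nonzero
  by (metis less_irrefl norm_one norm_power power_Suc_less_one zero_less_norm_iff)

lemma q_powi_neq_1:
  assumes "k \<noteq> 0"
  shows "q powi k \<noteq> 1"
proof (cases "k > 0")
  case True
  then have "q powi k = q ^ Suc (nat k - 1)"
    by (simp add: power_int_def)
  then show ?thesis
    using q_power_neq_1 by simp
next
  case False
  then have "inverse (q powi k) = q ^ Suc (nat (-k) - 1)"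
    using assms by (simp add: power_int_def flip: power_inverse)
  then show ?thesis
    using q_power_neq_1 by force
qed

text \<open>With \<open>koebe_inverse\<close>, the negative half of a two-sided sum becomes a
  one-sided sum starting from \<open>q / w\<close>.\<close>

lemma q_powi_minus_mult: "q powi (- int (Suc n)) * w = inverse (q ^ n * (q / w))"
  by (simp only: power_int_minus power_int_of_nat) (simp add: field_simps)

lemma koebe_summable_nat: "(\<lambda>n. koebe (q ^ n * w)) summable_on (UNIV :: nat set)"
  using norm_q norm_koebe_le by (rule summable_on_geometric_argument)

lemma koebe_summable: "(\<lambda>n. koebe (q powi n * w)) summable_on (UNIV :: int set)"
  using koebe_summable_nat[of w] koebe_summable_nat[of "q / w"]
  by (intro summable_on_intI) (simp_all only: q_powi_minus_mult koebe_inverse power_int_of_nat)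

text \<open>The terms \<open>1 / (1 - q powi n * w)\<close> tend to 1 as n grows and to 0 as n
  decreases. Subtracting a step function leaves the summable family \<open>p\<close>, which cancels
  against its shift, so only the step functions contribute.\<close>

lemma telescoping_has_sum:
  assumes w: "\<And>n :: int. q powi n * w \<noteq> 1" "w \<noteq> 0"
  shows "((\<lambda>n. 1 / (1 - q powi n * w) - 1 / (1 - q powi (n + k) * w)) has_sum (- of_int k)) UNIV"
proof -
  define p where "p n = 1 / (1 - q powi n * w) - of_bool (n \<ge> 0)" for n :: int
  have "(\<lambda>n. q ^ n * w / (1 - q ^ n * w)) summable_on UNIV"
    and "(\<lambda>n. q ^ n * (q / w) / (1 - q ^ n * (q / w))) summable_on UNIV"
    by (rule summable_on_geometric_argument[OF norm_q, where g = "\<lambda>x. x / (1 - x)"],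
        erule norm_divide_one_minus_le)+
  moreover have "p (int n) = q ^ n * w / (1 - q ^ n * w)" for n
    using w(1)[of "int n"] by (simp add: p_def field_simps)
  moreover have "p (- int (Suc n)) = - (q ^ n * (q / w) / (1 - q ^ n * (q / w)))" for n
  proof -
    define z where "z = q ^ n * (q / w)"
    have z: "q powi (- int (Suc n)) * w = inverse z"
      unfolding z_def by (rule q_powi_minus_mult)
    then have "inverse z \<noteq> 1"
      using w(1) by metis
    moreover have "z \<noteq> 0"
      using q_nonzero w by (simp add: z_def)
    moreover have "p (- int (Suc n)) = 1 / (1 - inverse z)"
      unfolding p_def z by simp
    ultimately show ?thesis
      unfolding z_def[symmetric] by (simp add: field_simps)
  qed
  ultimately have "p summable_on UNIV"
    by (intro summable_on_intI) (simp_all add: summable_on_uminus)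
  then obtain s where s: "(p has_sum s) UNIV"
    by (auto simp: summable_on_def)
  have "((\<lambda>n. (p n + - p (n + k)) + (of_bool (n \<ge> 0) - of_bool (n + k \<ge> 0)))
      has_sum ((s + - s) + - of_int k)) UNIV"
    by (intro has_sum_add has_sum_uminusI s has_sum_int_shift has_sum_int_step_shift)
  then show ?thesis
    by (simp add: p_def)
qed

definition koebe_sum :: "complex \<Rightarrow> complex" where
  "koebe_sum w = (\<Sum>\<^sub>\<infinity>n::int. koebe (q powi n * w))"

definition koebe_square_sum :: "complex \<Rightarrow> complex" where
  "koebe_square_sum w = (\<Sum>\<^sub>\<infinity>n::int. koebe (q powi n * w) ^ 2)"

text \<open>What the simple poles contribute in total over all shifts \<open>k\<close>. The
  essential point is that no \<open>w\<close> occurs.\<close>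

definition koebe_const :: complex where
  "koebe_const = (\<Sum>\<^sub>\<infinity>k::int. of_int k * (q powi k * (1 + q powi k) / (1 - q powi k) ^ 3))"

lemma koebe_sum_has_sum: "((\<lambda>n. koebe (q powi n * w)) has_sum koebe_sum w) UNIV"
  unfolding koebe_sum_def by (rule has_sum_infsum[OF koebe_summable])

text \<open>Pairs are indexed by the difference \<open>k\<close> of their exponents, since partial
  fractions apply at a fixed ratio \<open>q powi k\<close>.\<close>

lemma koebe_pairs_has_sum:
  "((\<lambda>(k, n). koebe (q powi n * w) * koebe (q powi (n + k) * w)) has_sum (koebe_sum w)\<^sup>2) (UNIV \<times> UNIV)"
  unfolding power2_eq_square
  by (rule iffD2[OF has_sum_reindex_bij_witness[where i = "\<lambda>(n, m). (m - n, n)"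
          and j = "\<lambda>(k, n). (n, n + k)"]
          has_sum_Times_complex[OF koebe_sum_has_sum koebe_sum_has_sum]]) auto

text \<open>The squares are the row \<open>k = 0\<close> of the summable family of pairs, which
  gives their convergence.\<close>

lemma koebe_square_sum_has_sum: "((\<lambda>n. koebe (q powi n * w) ^ 2) has_sum koebe_square_sum w) UNIV"
proof -
  have "(\<lambda>(k, n). koebe (q powi n * w) * koebe (q powi (n + k) * w)) summable_on (UNIV \<times> UNIV)"
    using koebe_pairs_has_sum by (rule has_sum_imp_summable)
  from summable_on_SigmaD1[OF this, of 0] show ?thesis
    unfolding koebe_square_sum_def by (intro has_sum_infsum) (simp add: power2_eq_square)
qed

text \<open>
  Expanding the square, the pairs \<open>(n, n + k)\<close> with fixed \<open>k \<noteq> 0\<close> are summed by partial fractions.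
  The diagonal terms \<open>k = 0\<close> of the other two sums vanish because of \<open>x / 0 = 0\<close>.
\<close>

lemma koebe_sum_square:
  assumes w: "\<And>n :: int. q powi n * w \<noteq> 1" "w \<noteq> 0"
  shows "(koebe_sum w)\<^sup>2 = koebe_square_sum w + 2 * koebe_sum 1 * koebe_sum w + koebe_const"
proof -
  define D where "D k = q powi k * (1 + q powi k) / (1 - q powi k) ^ 3" for k :: int
  define g where "g k = of_bool (k = 0) * koebe_square_sum w + 2 * koebe (q powi k) * koebe_sum w + of_int k * D k"
    for k :: int
  have inner: "((\<lambda>n. koebe (q powi n * w) * koebe (q powi (n + k) * w)) has_sum g k) UNIV" for k :: int
  proof (cases "k = 0")
    case True
    then show ?thesis
      using koebe_square_sum_has_sum[of w] by (simp add: g_def power2_eq_square)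
  next
    case False
    have "((\<lambda>n. koebe (q powi k) * (koebe (q powi n * w) + koebe (q powi (n + k) * w))
         + - D k * (1 / (1 - q powi n * w) - 1 / (1 - q powi (n + k) * w))) has_sum
         (koebe (q powi k) * (koebe_sum w + koebe_sum w) + - D k * - of_int k)) UNIV"
      by (intro has_sum_add has_sum_cmult_right telescoping_has_sum w koebe_sum_has_sum
          has_sum_int_shift[of "\<lambda>n. koebe (q powi n * w)"])
    moreover have "koebe (q powi n * w) * koebe (q powi (n + k) * w) =
        koebe (q powi k) * (koebe (q powi n * w) + koebe (q powi (n + k) * w))
         + - D k * (1 / (1 - q powi n * w) - 1 / (1 - q powi (n + k) * w))" for n
    proof -
      have *: "q powi (n + k) * w = q powi k * (q powi n * w)"
        using q_nonzero by (simp add: power_int_add)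
      show ?thesis
        using koebe_mult_koebe[OF w(1)[of n], of "q powi k"] w(1)[of "n + k"] q_powi_neq_1[OF False]
        unfolding * D_def by simp
    qed
    ultimately have "((\<lambda>n. koebe (q powi n * w) * koebe (q powi (n + k) * w)) has_sum
         (koebe (q powi k) * (koebe_sum w + koebe_sum w) + - D k * - of_int k)) UNIV"
      by (simp only:)
    then show ?thesis
      using False by (simp add: g_def algebra_simps)
  qed
  have "(g has_sum (koebe_sum w)\<^sup>2) UNIV"
    by (rule has_sum_Sigma'[OF koebe_pairs_has_sum]) (use inner in simp)
  moreover have "((\<lambda>k. of_bool (k = 0) * koebe_square_sum w) has_sum koebe_square_sum w) (UNIV :: int set)"
    by (rule has_sum_finite_neutralI[where B = "{0}"]) auto
  moreover have "((\<lambda>k. 2 * koebe (q powi k) * koebe_sum w) has_sum (2 * koebe_sum 1 * koebe_sum w)) UNIV"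
    using koebe_sum_has_sum[of 1] by (intro has_sum_cmult_left has_sum_cmult_right) simp
  \<comment> \<open>Subtracting the first two parts of \<open>g\<close> yields convergence of the
    series in \<open>koebe_const\<close> together with its value.\<close>
  ultimately have "((\<lambda>k. g k + (- (of_bool (k = 0) * koebe_square_sum w) + - (2 * koebe (q powi k) * koebe_sum w)))
      has_sum ((koebe_sum w)\<^sup>2 + (- koebe_square_sum w + - (2 * koebe_sum 1 * koebe_sum w)))) UNIV"
    by (intro has_sum_add has_sum_uminusI)
  then have "((\<lambda>k. of_int k * D k) has_sum
      ((koebe_sum w)\<^sup>2 + (- koebe_square_sum w + - (2 * koebe_sum 1 * koebe_sum w)))) UNIV"
    by (simp add: g_def)
  then have "koebe_const = (koebe_sum w)\<^sup>2 + (- koebe_square_sum w + - (2 * koebe_sum 1 * koebe_sum w))"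
    unfolding koebe_const_def D_def[symmetric] by (rule infsumI)
  then show ?thesis
    by simp
qed

end

section \<open>Power series in the coordinate \<open>X\<close>\<close>

text \<open>Differentiate the geometric series \<open>k\<close> times; each differentiation extends
  the rising factorial of \<open>j + 1\<close> by one factor.\<close>

lemma pochhammer_powser_sums:
  fixes y :: complex
  assumes "norm y < 1"
  shows "(\<lambda>j. pochhammer (of_nat j + 1) k * y ^ j) sums (fact k / (1 - y) ^ Suc k)"
  using assms
proof (induction k arbitrary: y)
  case 0
  then show ?case
    using geometric_sums[of y] by simp
next
  case (Suc k)
  have "y \<noteq> 1"
    using Suc.prems by auto
  then have "((\<lambda>y. fact k / (1 - y) ^ Suc k) has_field_derivative fact (Suc k) / (1 - y) ^ Suc (Suc k)) (at y)"
    by (auto intro!: derivative_eq_intros simp: divide_simps simp del: power_Suc)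
       (simp add: algebra_simps)
  then have "(\<lambda>j. diffs (\<lambda>j. pochhammer (of_nat j + 1) k) j * y ^ j) sums (fact (Suc k) / (1 - y) ^ Suc (Suc k))"
    by (rule termdiffs_sums_strong[where K = 1, rotated]) (use Suc.IH Suc.prems in blast)+
  moreover have "diffs (\<lambda>j. pochhammer (of_nat j + 1) k) j = pochhammer (of_nat j + 1 :: complex) (Suc k)" for j
    by (simp add: diffs_def pochhammer_rec add_ac)
  ultimately show ?case
    by simp
qed

lemma pochhammer_powser_has_sum:
  fixes y :: complex
  assumes "norm y < 1"
  shows "((\<lambda>j. pochhammer (of_nat j + 1) k * y ^ j) has_sum (fact k / (1 - y) ^ Suc k)) UNIV"
proof (rule norm_summable_imp_has_sum[OF _ pochhammer_powser_sums[OF assms]])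
  \<comment> \<open>Convergence at a real point strictly between \<open>norm y\<close> and 1 gives
    absolute convergence at \<open>y\<close>.\<close>
  obtain r where r: "norm y < r" "r < 1"
    using assms dense by blast
  have "summable (\<lambda>j. pochhammer (of_nat j + 1) k * of_real r ^ j :: complex)"
    using pochhammer_powser_sums[of "of_real r" k] r norm_ge_zero[of y] by (auto simp: sums_iff)
  then show "summable (\<lambda>j. norm (pochhammer (of_nat j + 1) k * y ^ j))"
    by (rule powser_insidea) (use r in auto)
qed

text \<open>A sequence polynomial in \<open>j\<close> thus has a generating function polynomial in
  \<open>1 / (1 - y)\<close>; only its coordinates \<open>b\<close> in the rising factorials must be
  supplied.\<close>

lemma has_sum_pochhammer_combination:
  fixes y :: complex
  assumes "norm y < 1"
    and "\<And>j. c j = (\<Sum>k\<le>N. b k * pochhammer (of_nat j + 1) k)"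
  shows "((\<lambda>j. c j * y ^ j) has_sum (\<Sum>k\<le>N. b k * (fact k / (1 - y) ^ Suc k))) UNIV"
proof -
  have "((\<lambda>j. b k * (pochhammer (of_nat j + 1) k * y ^ j)) has_sum b k * (fact k / (1 - y) ^ Suc k)) UNIV" for k
    by (intro has_sum_cmult_right pochhammer_powser_has_sum assms)
  then have "((\<lambda>j. \<Sum>k\<le>N. b k * (pochhammer (of_nat j + 1) k * y ^ j)) has_sum
      (\<Sum>k\<le>N. b k * (fact k / (1 - y) ^ Suc k))) UNIV"
    by (induction N) (simp_all only: sum.atMost_Suc has_sum_add atMost_0 sum.insert finite.emptyI
        empty_iff sum.empty add_0_right simp_thms)
  then show ?thesis
    by (simp add: assms(2) sum_distrib_left sum_distrib_right mult_ac)
qed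

text \<open>As \<open>X\<close> is symmetric under \<open>w\<close> -> \<open>1 / w\<close>, the
  denominators of \<open>koebe (t * w)\<close> and \<open>koebe (t / w)\<close> merge into one
  factor that is linear in \<open>X\<close>.\<close>

lemma one_minus_koebe_mult:
  assumes "t \<noteq> 1" and "w \<noteq> 0" and "X = w + 1 / w - 2"
  shows "(1 - t)\<^sup>2 * (1 - koebe t * X) = (1 - t * w) * (1 - t / w)"
proof -
  have "(1 - t)\<^sup>2 * (1 - koebe t * X) = (1 - t)\<^sup>2 - t * X"
    using assms(1) by (simp add: koebe_def field_simps)
  also have "\<dots> = (1 - t * w) * (1 - t / w)"
  proof -
    define v where "v = 1 / w"
    have "v * w = 1"
      using assms(2) by (simp add: v_def)
    then have "(1 - t)\<^sup>2 - t * (w + v - 2) = (1 - t * w) * (1 - t * v)"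
      by algebra
    then show ?thesis
      by (simp add: assms(3) v_def)
  qed
  finally show ?thesis .
qed

text \<open>Sum and product of the pair are symmetric under \<open>w\<close> ->
  \<open>1 / w\<close>, hence rational in \<open>X\<close>; the denominator comes from
  \<open>one_minus_koebe_mult\<close>.\<close>

lemma
  assumes t: "t \<noteq> 1" and w: "w \<noteq> 0" and X: "X = w + 1 / w - 2"
    and ne: "t * w \<noteq> 1" "t / w \<noteq> 1"
  defines "x \<equiv> koebe t"
  shows koebe_pair_add:
      "koebe (t * w) + koebe (t / w) = (x * X + 2 * x + 2 * x * (x * X)) / (1 - x * X)\<^sup>2"
    and koebe_pair_mult: "koebe (t * w) * koebe (t / w) = x\<^sup>2 / (1 - x * X)\<^sup>2"
proof -
  define v A B c where "v = 1 / w" and "A = 1 - t * w" and "B = 1 - t / w" and "c = 1 - t"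
  have nz: "A \<noteq> 0" "B \<noteq> 0" "c \<noteq> 0"
    using t ne by (auto simp: A_def B_def c_def)
  have vw: "v * w = 1"
    using w by (simp add: v_def)
  have X': "X = w + v - 2" and B': "B = 1 - t * v"
    by (simp_all add: X v_def B_def)
  have x: "x = t / c\<^sup>2"
    by (simp add: x_def koebe_def c_def)
  have "c\<^sup>2 * (1 - x * X) = A * B"
    unfolding x_def c_def A_def B_def by (rule one_minus_koebe_mult[OF t w X])
  then have 1: "1 - x * X = A * B / c\<^sup>2"
    using nz by (simp add: field_simps)
  have k: "koebe (t * w) = t * w / A\<^sup>2" "koebe (t / w) = t * v / B\<^sup>2"
    by (simp_all add: koebe_def A_def B_def v_def)
  have "t * w * B\<^sup>2 + t * v * A\<^sup>2 = t * X * c\<^sup>2 + 2 * t * c\<^sup>2 + 2 * t * (t * X)"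
    unfolding X' A_def B' c_def using vw by algebra
  then show "koebe (t * w) + koebe (t / w) = (x * X + 2 * x + 2 * x * (x * X)) / (1 - x * X)\<^sup>2"
    unfolding 1 k unfolding x using nz by (simp add: divide_simps power2_eq_square) (simp add: algebra_simps)
  have "koebe (t * w) * koebe (t / w) = t\<^sup>2 * (v * w) / (A * B)\<^sup>2"
    unfolding k by (simp add: power2_eq_square mult_ac)
  then show "koebe (t * w) * koebe (t / w) = x\<^sup>2 / (1 - x * X)\<^sup>2"
    unfolding 1 vw unfolding x using nz by (simp add: divide_simps power2_eq_square)
qed

text \<open>Read off \<open>koebe_pair_add\<close> with \<open>y = x * X\<close>: the part y / (1 -
  y)^2 has coefficients j, and 2 x (1 + y) / (1 - y)^2 has coefficients 2 x (2 j + 1).\<close>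

definition pair_coeff :: "nat \<Rightarrow> complex \<Rightarrow> complex" where
  "pair_coeff j x = of_nat j * x ^ j + (4 * of_nat j + 2) * x ^ Suc j"

text \<open>
  In the coordinate \<open>X = w + 1 / w - 2\<close>, the operator \<open>(w d/dw)\<^sup>2\<close> sends \<open>X\<^sup>j\<close> to
  \<open>j\<^sup>2 X\<^sup>j + j (4 j - 2) X\<^bsup>j - 1\<^esup>\<close>. As \<open>(w d/dw)\<^sup>2\<close> sends \<open>koebe\<close> to \<open>koebe + 6 koebe\<^sup>2\<close>, this gives the
  expansion of the squares.
\<close>

definition euler_coeff :: "(nat \<Rightarrow> complex) \<Rightarrow> nat \<Rightarrow> complex" where
  "euler_coeff h j = (((of_nat j)\<^sup>2 - 1) * h j + (4 * of_nat j + 2) * (of_nat j + 1) * h (Suc j)) / 6"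

text \<open>With \<open>y = x * X\<close>, both pair expressions are polynomials in \<open>x\<close>
  and \<open>d = 1 / (1 - y)\<close>, so rising factorials expand them. The sum of the squares is
  the square of the sum minus twice the product.\<close>

lemma
  assumes t: "t \<noteq> 1" and w: "w \<noteq> 0" and X: "X = w + 1 / w - 2"
    and ne: "t * w \<noteq> 1" "t / w \<noteq> 1" and small: "norm (koebe t * X) < 1"
  shows koebe_pair_has_sum:
      "((\<lambda>j. pair_coeff j (koebe t) * X ^ j) has_sum (koebe (t * w) + koebe (t / w))) UNIV"
    and koebe_square_pair_has_sum:
      "((\<lambda>j. euler_coeff (\<lambda>j. pair_coeff j (koebe t)) j * X ^ j) has_sum
         (koebe (t * w) ^ 2 + koebe (t / w) ^ 2)) UNIV"
proof -
  define x y d where "x = koebe t" and "y = x * X" and "d = 1 / (1 - y)"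
  have "y \<noteq> 1"
    using small by (auto simp: x_def y_def)
  then have yd: "y * d = d - 1"
    by (simp add: d_def field_simps)
  have nlt: "norm y < 1"
    using small by (simp add: x_def y_def)
  have fd: "(\<Sum>k\<le>3. b k * (fact k / (1 - y) ^ Suc k)) = b 0 * d + b 1 * d ^ 2 + 2 * b 2 * d ^ 3 + 6 * b 3 * d ^ 4"
    for b :: "nat \<Rightarrow> complex"
    by (simp add: d_def numeral_3_eq_3 fact_numeral eval_nat_numeral divide_simps)
  have sum_eq: "koebe (t * w) + koebe (t / w) = (y + 2 * x + 2 * x * y) * d\<^sup>2"
    using koebe_pair_add[OF t w X ne] by (simp add: x_def y_def d_def power_divide)
  have prod_eq: "koebe (t * w) * koebe (t / w) = x\<^sup>2 * d\<^sup>2"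
    using koebe_pair_mult[OF t w X ne] by (simp add: x_def y_def d_def power_divide)
  \<comment> \<open>From j = (j + 1) - 1 and 4 j + 2 = 4 (j + 1) - 2.\<close>
  define b1 where "b1 = (\<lambda>k::nat. if k = 0 then - 1 - 2 * x else if k = 1 then 1 + 4 * x else 0)"
  have "((\<lambda>j. (of_nat j + (4 * of_nat j + 2) * x) * y ^ j) has_sum
      (\<Sum>k\<le>3. b1 k * (fact k / (1 - y) ^ Suc k))) UNIV"
    by (rule has_sum_pochhammer_combination[OF nlt])
       (simp add: b1_def numeral_3_eq_3 pochhammer_Suc algebra_simps)
  moreover have "(of_nat j + (4 * of_nat j + 2) * x) * y ^ j = pair_coeff j x * X ^ j" for j
    by (simp add: pair_coeff_def y_def power_mult_distrib algebra_simps)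
  moreover have "(\<Sum>k\<le>3. b1 k * (fact k / (1 - y) ^ Suc k)) = (y + 2 * x + 2 * x * y) * d\<^sup>2"
    unfolding fd using yd by (simp add: b1_def) algebra
  ultimately show "((\<lambda>j. pair_coeff j (koebe t) * X ^ j) has_sum (koebe (t * w) + koebe (t / w))) UNIV"
    by (simp add: sum_eq flip: x_def)
  \<comment> \<open>Coordinates in rising factorials of j + 1 of the cubic below, which is
    \<open>euler_coeff\<close> of the pair coefficients with x^j taken out. It vanishes at j = -1,
    so the constant coordinate is 0.\<close>
  define b2 where "b2 = (\<lambda>k::nat. if k = 0 then 0 else if k = 1 then (6 + 24 * x + 12 * x\<^sup>2) / 6
    else if k = 2 then (- 6 - 36 * x - 48 * x\<^sup>2) / 6 else (1 + 8 * x + 16 * x\<^sup>2) / 6)"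
  have "((\<lambda>j. ((of_nat j ^ 3 - of_nat j) + (8 * of_nat j ^ 3 + 12 * of_nat j ^ 2 + 4 * of_nat j) * x
       + (4 * of_nat j + 2) * (of_nat j + 1) * (4 * of_nat j + 6) * x\<^sup>2) / 6 * y ^ j) has_sum
      (\<Sum>k\<le>3. b2 k * (fact k / (1 - y) ^ Suc k))) UNIV"
    by (rule has_sum_pochhammer_combination[OF nlt])
       (simp add: b2_def numeral_3_eq_3 pochhammer_Suc field_simps power2_eq_square power3_eq_cube)
  moreover have "((of_nat j ^ 3 - of_nat j) + (8 * of_nat j ^ 3 + 12 * of_nat j ^ 2 + 4 * of_nat j) * x
       + (4 * of_nat j + 2) * (of_nat j + 1) * (4 * of_nat j + 6) * x\<^sup>2) / 6 * y ^ j
      = euler_coeff (\<lambda>j. pair_coeff j x) j * X ^ j" for j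
    by (simp add: euler_coeff_def pair_coeff_def y_def power_mult_distrib field_simps
        power2_eq_square power3_eq_cube)
  moreover have "(\<Sum>k\<le>3. b2 k * (fact k / (1 - y) ^ Suc k)) =
      ((y + 2 * x + 2 * x * y) * d\<^sup>2)\<^sup>2 - 2 * (x\<^sup>2 * d\<^sup>2)"
    unfolding fd using yd by (simp add: b2_def) algebra
  moreover have "((y + 2 * x + 2 * x * y) * d\<^sup>2)\<^sup>2 - 2 * (x\<^sup>2 * d\<^sup>2) = koebe (t * w) ^ 2 + koebe (t / w) ^ 2"
    unfolding sum_eq[symmetric] prod_eq[symmetric] by algebra
  ultimately show "((\<lambda>j. euler_coeff (\<lambda>j. pair_coeff j (koebe t)) j * X ^ j) has_sum
         (koebe (t * w) ^ 2 + koebe (t / w) ^ 2)) UNIV"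
    by (simp flip: x_def)
qed

text \<open>Interchange of summation. The double family is dominated by the product of two summable
  families; summing over \<open>j\<close> first gives \<open>s\<close>, over \<open>n\<close> first
  gives the coefficients \<open>h\<close>.\<close>

lemma has_sum_powser_family:
  fixes a u :: "nat \<Rightarrow> complex" and C :: "nat \<Rightarrow> nat \<Rightarrow> complex"
  assumes a: "a summable_on UNIV" and B: "(\<lambda>j. of_real (B j) * X ^ j) summable_on UNIV"
    and bound: "\<And>j n. norm (C j n) \<le> B j * norm (a n)"
    and u: "\<And>n. ((\<lambda>j. C j n * X ^ j) has_sum u n) UNIV" and s: "(u has_sum s) UNIV"
    and h: "\<And>j. (C j has_sum h j) UNIV"
  shows "((\<lambda>j. h j * X ^ j) has_sum s) UNIV"
proof -
  have "(\<lambda>(n, j). a n * (of_real (B j) * X ^ j)) summable_on UNIV \<times> UNIV"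
    using has_sum_Times_complex[OF has_sum_infsum[OF a] has_sum_infsum[OF B]]
    by (rule has_sum_imp_summable)
  then have "(\<lambda>p. norm (case p of (n, j) \<Rightarrow> a n * (of_real (B j) * X ^ j))) summable_on UNIV \<times> UNIV"
    by (simp add: summable_on_iff_abs_summable_on_complex)
  then have "(\<lambda>p. norm (case p of (n, j) \<Rightarrow> C j n * X ^ j)) summable_on UNIV \<times> UNIV"
  proof (rule Infinite_Sum.abs_summable_on_comparison_test)
    fix p :: "nat \<times> nat"
    have "norm (C j n) * norm (X ^ j) \<le> norm (a n) * (\<bar>B j\<bar> * norm (X ^ j))" for n j
    proof -
      have "norm (C j n) \<le> norm (a n) * \<bar>B j\<bar>"
        using bound[of j n] mult_right_mono[OF abs_ge_self[of "B j"], of "norm (a n)"]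
        by (simp add: mult.commute)
      then show ?thesis
        by (metis mult.assoc mult_right_mono norm_ge_zero)
    qed
    then show "norm (case p of (n, j) \<Rightarrow> C j n * X ^ j) \<le>
        norm (case p of (n, j) \<Rightarrow> a n * (of_real (B j) * X ^ j))"
      by (simp add: norm_mult split: prod.split)
  qed
  then have "(\<lambda>(n, j). C j n * X ^ j) summable_on UNIV \<times> UNIV"
    by (simp add: summable_on_iff_abs_summable_on_complex)
  then have "((\<lambda>(n, j). C j n * X ^ j) has_sum s) (UNIV \<times> UNIV)"
    by (intro has_sum_SigmaI[where g = u]) (use u s in auto)
  then have "((\<lambda>(j, n). C j n * X ^ j) has_sum s) (UNIV \<times> UNIV)"
    by (subst (asm) has_sum_swap) (simp add: case_prod_unfold)
  then show ?thesis
    by (rule has_sum_SigmaD) (use has_sum_cmult_left[OF h] in simp)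
qed

section \<open>The recurrence for the power sums\<close>

text \<open>The coefficients are derivatives at 0, which depend only on the function near 0.\<close>

lemma fps_eq_0_of_eventually_0:
  fixes f :: "complex \<Rightarrow> complex"
  assumes f: "f has_fps_expansion F" and ev: "eventually (\<lambda>z. f z = 0) (nhds 0)"
  shows "F = 0"
proof -
  have "(\<lambda>_. 0) has_fps_expansion F"
    using f unfolding has_fps_expansion_def
    by (auto intro: eventually_elim2[OF _ ev])
  then have "fps_nth F n = (deriv ^^ n) (\<lambda>_. 0) 0 / fact n" for n
    by (rule fps_nth_fps_expansion)
  also have "(deriv ^^ n) (\<lambda>_. 0) 0 / fact n = fps_nth (0 :: complex fps) n" for n
    by (rule fps_nth_fps_expansion[symmetric]) simp
  finally show ?thesis
    by (intro fps_ext) simp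
qed

text \<open>The bound separates \<open>j\<close> from \<open>x\<close>, as
  \<open>has_sum_powser_family\<close> requires: one factor \<open>norm x\<close> remains for the
  sum over n, the other powers of \<open>x\<close> go into \<open>M ^ j\<close>.\<close>

lemma norm_pair_coeff_le:
  assumes "norm x \<le> M" and "M \<ge> 1"
  shows "norm (pair_coeff j x) \<le> (5 * real j + 2) * M ^ j * norm x"
proof -
  have 1: "norm (of_nat j * x ^ j) \<le> real j * M ^ j * norm x"
  \<comment> \<open>At 0 the factor \<open>j\<close> is 0; otherwise \<open>x ^ j\<close> has a
    factor \<open>x\<close> to split off.\<close>
  proof (cases j)
    case (Suc i)
    have "norm x ^ i \<le> M ^ i"
      using assms by (intro power_mono) auto
    also have "\<dots> \<le> M ^ j"
      using assms Suc by (intro power_increasing) auto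
    finally have "norm x ^ i * norm x \<le> M ^ j * norm x"
      by (intro mult_right_mono) auto
    then have "real j * (norm x ^ i * norm x) \<le> real j * (M ^ j * norm x)"
      by (intro mult_left_mono) auto
    moreover have "norm (of_nat j * x ^ j) = real j * (norm x ^ i * norm x)"
      by (simp only: norm_mult norm_of_nat norm_power Suc power_Suc2)
    ultimately show ?thesis
      by (simp only: mult.assoc)
  qed auto
  have "norm x ^ j \<le> M ^ j"
    using assms by (intro power_mono) auto
  then have "(4 * real j + 2) * (norm x ^ j * norm x) \<le> (4 * real j + 2) * (M ^ j * norm x)"
    by (intro mult_left_mono mult_right_mono) auto
  moreover have "norm ((4 * of_nat j + 2) * x ^ Suc j) = (4 * real j + 2) * (norm x ^ j * norm x)"
  proof -
    have "norm (4 * of_nat j + 2 :: complex) = norm (of_nat (4 * j + 2) :: complex)"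
      by (simp add: add.commute)
    also have "\<dots> = 4 * real j + 2"
      unfolding norm_of_nat by simp
    finally show ?thesis
      by (simp only: norm_mult norm_power power_Suc2)
  qed
  ultimately have 2: "norm ((4 * of_nat j + 2) * x ^ Suc j) \<le> (4 * real j + 2) * M ^ j * norm x"
    by (simp only: mult.assoc)
  show ?thesis
    unfolding pair_coeff_def using norm_triangle_le[OF add_mono[OF 1 2]]
    by (simp add: algebra_simps)
qed

text \<open>The shifted coefficient \<open>h (Suc j)\<close> costs one more power of
  \<open>M\<close>. The cubic is a rising factorial of \<open>j + 1\<close>, whose power series is
  known to converge; 10 is the crude constant 60 over the 6 in \<open>euler_coeff\<close>.\<close>

lemma norm_euler_coeff_le:
  assumes "norm x \<le> M" and "M \<ge> 1"
  shows "norm (euler_coeff (\<lambda>j. pair_coeff j x) j)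
      \<le> 10 * ((real j + 1) * (real j + 2) * (real j + 3)) * M ^ Suc j * norm x"
proof -
  let ?A = "((of_nat j)\<^sup>2 - 1) * pair_coeff j x"
  let ?B = "(4 * of_nat j + 2) * (of_nat j + 1) * pair_coeff (Suc j) x"
  have "norm ((of_nat j)\<^sup>2 - 1 :: complex) \<le> (real j)\<^sup>2 + 1"
    using norm_triangle_ineq4[of "(of_nat j)\<^sup>2 :: complex" 1] by (simp add: norm_power)
  then have "norm ?A \<le> ((real j)\<^sup>2 + 1) * ((5 * real j + 2) * M ^ j * norm x)"
    unfolding norm_mult by (intro mult_mono norm_pair_coeff_le assms) auto
  also have "\<dots> \<le> ((real j)\<^sup>2 + 1) * ((5 * real j + 2) * M ^ Suc j * norm x)"
    using assms by (intro mult_left_mono mult_right_mono power_increasing) auto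
  finally have A: "norm ?A \<le> ((real j)\<^sup>2 + 1) * (5 * real j + 2) * (M ^ Suc j * norm x)"
    by (simp only: mult.assoc)
  have "norm ((4 * of_nat j + 2) * (of_nat j + 1) :: complex) = norm (of_nat ((4 * j + 2) * (j + 1)) :: complex)"
    by (simp add: algebra_simps)
  also have "\<dots> = (4 * real j + 2) * (real j + 1)"
    unfolding norm_of_nat by (simp add: algebra_simps)
  finally have "norm ?B = (4 * real j + 2) * (real j + 1) * norm (pair_coeff (Suc j) x)"
    by (simp only: norm_mult)
  also have "\<dots> \<le> (4 * real j + 2) * (real j + 1) * ((5 * real (Suc j) + 2) * M ^ Suc j * norm x)"
    by (intro mult_left_mono norm_pair_coeff_le assms) auto
  also have "5 * real (Suc j) + 2 = 5 * real j + 7"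
    by simp
  finally have B: "norm ?B \<le> (4 * real j + 2) * (real j + 1) * (5 * real j + 7) * (M ^ Suc j * norm x)"
    by (simp only: mult.assoc)
  have "norm (?A + ?B) \<le> (((real j)\<^sup>2 + 1) * (5 * real j + 2)
      + (4 * real j + 2) * (real j + 1) * (5 * real j + 7)) * (M ^ Suc j * norm x)"
    using norm_triangle_le[OF add_mono[OF A B]] by (simp only: distrib_right)
  also have "\<dots> \<le> (60 * ((real j + 1) * (real j + 2) * (real j + 3))) * (M ^ Suc j * norm x)"
    using assms by (intro mult_right_mono) (auto simp: algebra_simps power2_eq_square)
  finally show ?thesis
    by (simp add: euler_coeff_def norm_divide)
qed

lemma cubic_powser_summable:
  fixes z :: complex
  assumes "norm z < 1"
  shows "(\<lambda>j. of_real ((real j + 1) * (real j + 2) * (real j + 3)) * z ^ j) summable_on UNIV"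
  using has_sum_imp_summable[OF pochhammer_powser_has_sum[OF assms, of 3]]
  by (simp add: pochhammer_Suc numeral_3_eq_3 add_ac mult_ac)

section \<open>Power sums, functional equation and comparison of coefficients\<close>

context punctured_disc
begin

definition koebe_power_sum :: "nat \<Rightarrow> complex" where
  "koebe_power_sum s = (\<Sum>\<^sub>\<infinity>n. koebe (q ^ Suc n) ^ s)"

lemma koebe_powers_summable: "(\<lambda>n. koebe (q ^ Suc n)) summable_on UNIV"
  using koebe_summable_nat[of q] by (simp add: mult.commute)

lemma koebe_powers_bounded: "\<exists>M\<ge>1. \<forall>n. norm (koebe (q ^ Suc n)) \<le> M"
proof -
  have "Bseq (\<lambda>n. koebe (q ^ Suc n))"
    by (rule convergent_imp_Bseq[OF convergentI[OF summable_LIMSEQ_zero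
            [OF summable_on_imp_summable[OF koebe_powers_summable]]]])
  then obtain K where "\<And>n. norm (koebe (q ^ Suc n)) \<le> K"
    by (auto simp: Bseq_def)
  then show ?thesis
    by (intro exI[of _ "max 1 K"]) (auto simp: le_max_iff_disj)
qed

text \<open>The terms are bounded by \<open>M\<close>, so all but one of the \<open>s\<close>
  factors are absorbed in a constant.\<close>

lemma koebe_power_sum_has_sum:
  assumes "s \<ge> 1"
  shows "((\<lambda>n. koebe (q ^ Suc n) ^ s) has_sum koebe_power_sum s) UNIV"
proof -
  obtain M where M: "M \<ge> 1" "\<And>n. norm (koebe (q ^ Suc n)) \<le> M"
    using koebe_powers_bounded by blast
  have "(\<lambda>n. of_real (M ^ (s - 1)) * koebe (q ^ Suc n)) summable_on UNIV"
    by (intro summable_on_cmult_right koebe_powers_summable)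
  then have "(\<lambda>n. norm (of_real (M ^ (s - 1)) * koebe (q ^ Suc n))) summable_on UNIV"
    by (simp only: summable_on_iff_abs_summable_on_complex)
  then have "(\<lambda>n. norm (koebe (q ^ Suc n) ^ s)) summable_on UNIV"
  proof (rule Infinite_Sum.abs_summable_on_comparison_test)
    fix n
    have "norm (koebe (q ^ Suc n)) ^ (s - 1) * norm (koebe (q ^ Suc n)) \<le> M ^ (s - 1) * norm (koebe (q ^ Suc n))"
      using M by (intro mult_right_mono power_mono) auto
    moreover have "norm (koebe (q ^ Suc n) ^ s) = norm (koebe (q ^ Suc n)) ^ (s - 1) * norm (koebe (q ^ Suc n))"
      using assms by (simp only: norm_power flip: power_Suc2) simp
    ultimately show "norm (koebe (q ^ Suc n) ^ s) \<le> norm (of_real (M ^ (s - 1)) * koebe (q ^ Suc n))"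
      using M by (simp only: norm_mult norm_of_real) simp
  qed
  then show ?thesis
    unfolding koebe_power_sum_def
    by (intro has_sum_infsum) (simp only: summable_on_iff_abs_summable_on_complex)
qed

text \<open>The coefficients of F - 1 / X as a power series in X. At 0 the factor
  \<open>of_nat j\<close> removes the divergent sum and leaves 2 P_1.\<close>

definition koebe_coeff :: "nat \<Rightarrow> complex" where
  "koebe_coeff j = of_nat j * koebe_power_sum j + (4 * of_nat j + 2) * koebe_power_sum (Suc j)"

lemma koebe_coeff_has_sum: "((\<lambda>n. pair_coeff j (koebe (q ^ Suc n))) has_sum koebe_coeff j) UNIV"
  unfolding pair_coeff_def koebe_coeff_def
proof (intro has_sum_add)
  show "((\<lambda>n. of_nat j * koebe (q ^ Suc n) ^ j) has_sum of_nat j * koebe_power_sum j) UNIV"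
    by (cases "j = 0") (auto intro!: has_sum_cmult_right koebe_power_sum_has_sum simp del: power_Suc)
qed (intro has_sum_cmult_right koebe_power_sum_has_sum, simp)

lemma euler_coeff_has_sum:
  "((\<lambda>n. euler_coeff (\<lambda>j. pair_coeff j (koebe (q ^ Suc n))) j) has_sum euler_coeff koebe_coeff j) UNIV"
proof -
  have "((\<lambda>n. (((of_nat j)\<^sup>2 - 1) * pair_coeff j (koebe (q ^ Suc n))
       + (4 * of_nat j + 2) * (of_nat j + 1) * pair_coeff (Suc j) (koebe (q ^ Suc n))) * (1 / 6))
      has_sum (((of_nat j)\<^sup>2 - 1) * koebe_coeff j
       + (4 * of_nat j + 2) * (of_nat j + 1) * koebe_coeff (Suc j)) * (1 / 6)) UNIV"
    by (intro has_sum_add has_sum_cmult_right has_sum_cmult_left koebe_coeff_has_sum)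
  then show ?thesis
    by (simp add: euler_coeff_def)
qed

text \<open>The term at 0 is \<open>koebe 1 = 0\<close>, and the terms at n and -n coincide, giving
  2 P_1.\<close>

lemma koebe_sum_1: "koebe_sum 1 = koebe_coeff 0"
proof -
  have "((\<lambda>n. koebe (q ^ Suc n) + koebe (q ^ Suc n)) has_sum koebe_sum 1) UNIV"
    using has_sum_int_fold[OF koebe_sum_has_sum[of 1]]
    by (simp only: power_int_of_nat power_int_minus koebe_inverse mult_1_right power_int_0_right
        koebe_1 diff_zero)
  from has_sum_unique[OF this] koebe_coeff_has_sum[of 0] show ?thesis
    by (simp add: pair_coeff_def)
qed

text \<open>For \<open>w\<close> lying over \<open>X\<close>, the two-sided sums are
  \<open>1 / X + H\<close> and \<open>(1 / X)\<^sup>2 + V\<close>; multiplying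
  \<open>koebe_sum_square\<close> by \<open>X\<close> clears the poles.\<close>

lemma generating_function_relation:
  assumes M: "M \<ge> 1" "\<And>n. norm (koebe (q ^ Suc n)) \<le> M" and X: "X \<noteq> 0" "M * norm X < 1"
  shows "\<exists>H V. (\<lambda>j. koebe_coeff j * X ^ j) sums H \<and> (\<lambda>j. euler_coeff koebe_coeff j * X ^ j) sums V \<and>
     2 * H + X * H\<^sup>2 = X * V + 2 * koebe_coeff 0 + 2 * koebe_coeff 0 * X * H + koebe_const * X"
proof -
  have small: "norm (koebe (q ^ Suc n) * X) < 1" for n
    using M(2)[of n] X(2) mult_right_mono[of "norm (koebe (q ^ Suc n))" M "norm X"]
    by (simp only: norm_mult) (meson le_less_trans norm_ge_zero)
  \<comment> \<open>A root of w^2 - (2 + X) w + 1.\<close>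
  define w where "w = ((2 + X) + csqrt ((2 + X)\<^sup>2 - 4)) / 2"
  have quad: "w\<^sup>2 + 1 = (2 + X) * w"
  proof -
    have "(csqrt ((2 + X)\<^sup>2 - 4))\<^sup>2 = (2 + X)\<^sup>2 - 4"
      by simp
    then show ?thesis
      unfolding w_def by (simp add: field_simps power2_eq_square)
  qed
  then have w0: "w \<noteq> 0"
    by auto
  with quad have Xw: "X = w + 1 / w - 2"
    by (simp add: field_simps power2_eq_square)
  have "w \<noteq> 1"
    using Xw X by auto
  \<comment> \<open>If either were 1, \<open>one_minus_koebe_mult\<close> would make
    \<open>1 - koebe (q ^ Suc n) * X\<close> zero, against \<open>small\<close>.\<close>
  have ne: "q ^ Suc n * w \<noteq> 1 \<and> q ^ Suc n / w \<noteq> 1" for n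
  proof -
    have "1 - koebe (q ^ Suc n) * X \<noteq> 0"
      using small[of n] by auto
    moreover have "1 - q ^ Suc n \<noteq> 0"
      using q_power_neq_1[of n] by (metis right_minus_eq)
    ultimately have "(1 - q ^ Suc n)\<^sup>2 * (1 - koebe (q ^ Suc n) * X) \<noteq> 0"
      by simp
    then show ?thesis
      unfolding one_minus_koebe_mult[OF q_power_neq_1 w0 Xw] by auto
  qed
  have pow_neg: "q powi (- int (Suc n)) * w = inverse (q ^ Suc n / w)" for n
    by (simp only: power_int_minus power_int_of_nat) (simp add: field_simps)
  have poles: "q powi n * w \<noteq> 1" for n :: int
  proof -
    consider "n = 0" | m where "n = int (Suc m)" | m where "n = - int (Suc m)"
      by (metis int_cases int_cases2 not0_implies_Suc of_nat_0 neg_0_equal_iff_equal)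
    then show ?thesis
    proof cases
      case 1
      then show ?thesis using \<open>w \<noteq> 1\<close> by simp
    next
      case 2
      then show ?thesis using ne[of m] by (simp only: power_int_of_nat) simp
    next
      case 3
      have "inverse (q ^ Suc m / w) \<noteq> 1"
        using ne[of m] by (metis inverse_1 inverse_inverse_eq)
      then show ?thesis unfolding 3 pow_neg .
    qed
  qed
  \<comment> \<open>The term at n = 0 carries the pole, because X = (w - 1)^2 / w.\<close>
  have k0: "koebe w = 1 / X"
    using w0 \<open>w \<noteq> 1\<close> unfolding koebe_def Xw by (simp add: field_simps power2_eq_square)
  have H: "((\<lambda>n. koebe (q ^ Suc n * w) + koebe (q ^ Suc n / w)) has_sum (koebe_sum w - 1 / X)) UNIV"
    using has_sum_int_fold[OF koebe_sum_has_sum[of w]]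
    by (simp only: pow_neg power_int_of_nat koebe_inverse power_int_0_right mult_1_left k0)
  have V: "((\<lambda>n. koebe (q ^ Suc n * w) ^ 2 + koebe (q ^ Suc n / w) ^ 2) has_sum (koebe_square_sum w - (1 / X)\<^sup>2)) UNIV"
    using has_sum_int_fold[OF koebe_square_sum_has_sum[of w]]
    by (simp only: pow_neg power_int_of_nat koebe_inverse power_int_0_right mult_1_left k0)
  \<comment> \<open>The larger of the two coefficient bounds serves both families.\<close>
  define B where "B j = 10 * ((real j + 1) * (real j + 2) * (real j + 3)) * M ^ Suc j" for j
  have "(\<lambda>j. 10 * of_real M * (of_real ((real j + 1) * (real j + 2) * (real j + 3)) * (of_real M * X) ^ j))
      summable_on UNIV"
    using X M by (intro summable_on_cmult_right cubic_powser_summable) (simp add: norm_mult)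
  then have B: "(\<lambda>j. of_real (B j) * X ^ j) summable_on UNIV"
    by (simp only: B_def power_mult_distrib of_real_mult of_real_power of_real_numeral power_Suc mult_ac)
  have bound1: "norm (pair_coeff j (koebe (q ^ Suc n))) \<le> B j * norm (koebe (q ^ Suc n))" for j n
  proof -
    have "(5 * real j + 2) * M ^ j \<le> (10 * ((real j + 1) * (real j + 2) * (real j + 3))) * M ^ Suc j"
      using M(1) by (intro mult_mono power_increasing) (auto simp: algebra_simps)
    then show ?thesis
      using norm_pair_coeff_le[OF M(2)[of n] M(1), of j]
        mult_right_mono[of _ _ "norm (koebe (q ^ Suc n))"] unfolding B_def
      by (meson norm_ge_zero order_trans)
  qed
  have "((\<lambda>j. koebe_coeff j * X ^ j) has_sum (koebe_sum w - 1 / X)) UNIV"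
    by (rule has_sum_powser_family[OF koebe_powers_summable B bound1 _ H koebe_coeff_has_sum])
       (intro koebe_pair_has_sum[OF _ w0 Xw] small q_power_neq_1 ne[THEN conjunct1] ne[THEN conjunct2])
  moreover have "((\<lambda>j. euler_coeff koebe_coeff j * X ^ j) has_sum (koebe_square_sum w - (1 / X)\<^sup>2)) UNIV"
    by (rule has_sum_powser_family[OF koebe_powers_summable B
          norm_euler_coeff_le[OF M(2,1), folded B_def] _ V euler_coeff_has_sum])
       (intro koebe_square_pair_has_sum[OF _ w0 Xw]
          small q_power_neq_1 ne[THEN conjunct1] ne[THEN conjunct2])
  moreover have "2 * H + X * H\<^sup>2 = X * V + 2 * koebe_coeff 0 + 2 * koebe_coeff 0 * X * H + koebe_const * X"
    if "H = koebe_sum w - 1 / X" "V = koebe_square_sum w - (1 / X)\<^sup>2" for H V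
  proof -
    have "(1 / X + H)\<^sup>2 = (V + (1 / X)\<^sup>2) + 2 * koebe_coeff 0 * (1 / X + H) + koebe_const"
      using koebe_sum_square[OF poles w0] by (simp add: koebe_sum_1 that)
    moreover have "1 / X * X = 1"
      using X(1) by simp
    ultimately show ?thesis
      by algebra
  qed
  ultimately show ?thesis
    by (blast intro: has_sum_imp_sums)
qed

text \<open>Compare coefficients of \<open>X ^ Suc j\<close> in the functional equation. For j \<ge>
  1 the terms \<open>2 * koebe_coeff 0\<close> and \<open>koebe_const * X\<close> are of too low
  degree to enter.\<close>

lemma koebe_coeff_recurrence:
  assumes "j \<ge> 1"
  shows "2 * koebe_coeff (Suc j) + (\<Sum>i\<le>j. koebe_coeff i * koebe_coeff (j - i))
     = euler_coeff koebe_coeff j + 2 * koebe_coeff 0 * koebe_coeff j"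
proof -
  obtain M where M: "M \<ge> 1" "\<And>n. norm (koebe (q ^ Suc n)) \<le> M"
    using koebe_powers_bounded by blast
  define H V where "H X = (\<Sum>j. koebe_coeff j * X ^ j)"
    and "V X = (\<Sum>j. euler_coeff koebe_coeff j * X ^ j)" for X
  have rel: "(\<lambda>j. koebe_coeff j * X ^ j) sums H X \<and> (\<lambda>j. euler_coeff koebe_coeff j * X ^ j) sums V X \<and>
      2 * H X + X * (H X)\<^sup>2 = X * V X + 2 * koebe_coeff 0 + 2 * koebe_coeff 0 * X * H X + koebe_const * X"
    if "norm X < 1 / M" for X
  \<comment> \<open>The coordinate change covers X \<noteq> 0. At 0 the series reduce to their
    constant terms, since \<open>0 ^ 0 = 1\<close>.\<close>
  proof (cases "X = 0")
    case True
    have zero: "(\<lambda>j. c j * 0 ^ j) sums c 0" for c :: "nat \<Rightarrow> complex"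
      by (rule powser_sums_zero)
    have "H 0 = koebe_coeff 0" "V 0 = euler_coeff koebe_coeff 0"
      unfolding H_def V_def by (rule sums_unique[OF zero, symmetric])+
    then show ?thesis
      using zero by (simp only: True) simp
  next
    case False
    have "M * norm X < 1"
      using that M(1) by (simp add: field_simps)
    from generating_function_relation[OF M False this] show ?thesis
      unfolding H_def V_def by (auto simp: sums_iff)
  qed
  have "eventually (\<lambda>X. X \<in> ball 0 (1 / M)) (nhds (0 :: complex))"
    using M by (intro eventually_nhds_in_open) auto
  then have ev: "eventually (\<lambda>X. norm X < 1 / M) (nhds (0 :: complex))"
    by simp
  have [fps_expansion_intros]: "H has_fps_expansion Abs_fps koebe_coeff"
    by (rule has_fps_expansionI, rule eventually_mono[OF ev]) (use rel in simp)
  have [fps_expansion_intros]: "V has_fps_expansion Abs_fps (euler_coeff koebe_coeff)"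
    by (rule has_fps_expansionI, rule eventually_mono[OF ev]) (use rel in simp)
  \<comment> \<open>The formal counterpart of left side minus right side.\<close>
  define G where "G = 2 * Abs_fps koebe_coeff + fps_X * (Abs_fps koebe_coeff * Abs_fps koebe_coeff)
     - (fps_X * Abs_fps (euler_coeff koebe_coeff) + fps_const (2 * koebe_coeff 0)
        + fps_const (2 * koebe_coeff 0) * (fps_X * Abs_fps koebe_coeff) + fps_const koebe_const * fps_X)"
  have "(\<lambda>X. 2 * H X + X * (H X * H X) -
     (X * V X + 2 * koebe_coeff 0 + 2 * koebe_coeff 0 * (X * H X) + koebe_const * X)) has_fps_expansion G"
    unfolding G_def by (intro fps_expansion_intros)
  then have "G = 0"
  proof (rule fps_eq_0_of_eventually_0)
    show "eventually (\<lambda>X. 2 * H X + X * (H X * H X) -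
        (X * V X + 2 * koebe_coeff 0 + 2 * koebe_coeff 0 * (X * H X) + koebe_const * X) = 0) (nhds 0)"
      using ev by eventually_elim (use rel in \<open>simp add: power2_eq_square mult.assoc\<close>)
  qed
  then have "fps_nth G (Suc j) = 0"
    by simp
  moreover have "fps_nth (Abs_fps koebe_coeff * Abs_fps koebe_coeff) j
      = (\<Sum>i\<le>j. koebe_coeff i * koebe_coeff (j - i))"
    by (simp add: fps_mult_nth atLeast0AtMost)
  ultimately show ?thesis
    using assms by (simp add: G_def)
qed

end

section \<open>Newton's identities for the series\<close>

text \<open>These finite truncations give elementary symmetric polynomials in finitely many
  variables.\<close>

definition bounded_tuples :: "nat \<Rightarrow> nat \<Rightarrow> nat list set" where
  "bounded_tuples a N = {ns \<in> index_tuples a. set ns \<subseteq> {..N}}"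

lemma finite_bounded_tuples: "finite (bounded_tuples a N)"
  by (rule finite_subset[OF _ finite_lists_length_eq[of "{..N}" a]])
     (auto simp: bounded_tuples_def index_tuples_def)

lemma bounded_tuples_0 [simp]: "bounded_tuples 0 N = {[]}"
  by (auto simp: bounded_tuples_def index_tuples_def)

lemma bounded_tuples_Suc_0 [simp]: "bounded_tuples (Suc a) 0 = {}"
proof -
  have False if "ns \<in> bounded_tuples (Suc a) 0" for ns
    using that by (cases ns) (auto simp: bounded_tuples_def index_tuples_def)
  then show ?thesis
    by blast
qed

text \<open>Split by whether the largest entry, which stands last, equals
  \<open>Suc N\<close>.\<close>

lemma bounded_tuples_Suc_Suc:
  "bounded_tuples (Suc a) (Suc N) =
     bounded_tuples (Suc a) N \<union> (\<lambda>ns. ns @ [Suc N]) ` bounded_tuples a N" (is "?L = ?R")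
proof
  show "?R \<subseteq> ?L"
    by (force simp: bounded_tuples_def index_tuples_def sorted_wrt_append)
  show "?L \<subseteq> ?R"
  proof
    fix ns assume ns: "ns \<in> ?L"
    then obtain ms m where ms: "ns = ms @ [m]"
      by (cases ns rule: rev_cases) (auto simp: bounded_tuples_def index_tuples_def)
    with ns have "m \<le> Suc N" and "ms \<in> index_tuples a" and less: "\<forall>n\<in>set ms. n < m"
      by (auto simp: bounded_tuples_def index_tuples_def sorted_wrt_append)
    show "ns \<in> ?R"
    proof (cases "m = Suc N")
      case True
      then have "ms \<in> bounded_tuples a N"
        using less \<open>ms \<in> index_tuples a\<close> by (auto simp: bounded_tuples_def less_Suc_eq_le)
      then show ?thesis
        using ms True by auto
    next
      case False
      then have "set ns \<subseteq> {..N}"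
        using less \<open>m \<le> Suc N\<close> ms by fastforce
      then show ?thesis
        using ns by (auto simp: bounded_tuples_def)
    qed
  qed
qed

text \<open>Multiplying by one more linear factor matches the split in
  \<open>bounded_tuples_Suc_Suc\<close>.\<close>

lemma fps_nth_prod_linear:
  fixes y :: "nat \<Rightarrow> 'a :: comm_ring_1"
  shows "fps_nth (\<Prod>n<N. 1 + fps_const (y (Suc n)) * fps_X) a = (\<Sum>ns\<in>bounded_tuples a N. prod_list (map y ns))"
proof (induction N arbitrary: a)
  case 0
  then show ?case
    by (cases a) auto
next
  case (Suc N)
  let ?E = "\<Prod>n<N. 1 + fps_const (y (Suc n)) * fps_X"
  show ?case
  proof (cases a)
    case 0
    then show ?thesis
      using Suc[of 0] by simp
  next
    case (Suc b)
    have "(\<Sum>ns\<in>(\<lambda>ns. ns @ [Suc N]) ` bounded_tuples b N. prod_list (map y ns))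
        = (\<Sum>ns\<in>bounded_tuples b N. prod_list (map y ns)) * y (Suc N)"
      by (subst sum.reindex) (auto simp: inj_on_def sum_distrib_right)
    moreover have "bounded_tuples (Suc b) N \<inter> (\<lambda>ns. ns @ [Suc N]) ` bounded_tuples b N = {}"
      by (auto simp: bounded_tuples_def)
    ultimately have "(\<Sum>ns\<in>bounded_tuples (Suc b) (Suc N). prod_list (map y ns))
        = fps_nth ?E (Suc b) + fps_nth ?E b * y (Suc N)"
      unfolding bounded_tuples_Suc_Suc Suc.IH
      by (subst sum.union_disjoint) (auto simp: finite_bounded_tuples)
    also have "\<dots> = fps_nth (?E * (1 + fps_const (y (Suc N)) * fps_X)) (Suc b)"
    proof -
      have "?E * (1 + fps_const (y (Suc N)) * fps_X) = ?E + fps_X * (fps_const (y (Suc N)) * ?E)"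
        by (simp add: algebra_simps)
      then show ?thesis
        by (simp add: mult.commute)
    qed
    finally show ?thesis
      using Suc by simp
  qed
qed

text \<open>The logarithmic derivative of \<open>\<Prod>(1 + y\<^sub>n X)\<close> is \<open>\<Sum> y\<^sub>n / (1 + y\<^sub>n X)\<close>.\<close>

lemma fps_deriv_prod_linear:
  fixes y :: "nat \<Rightarrow> 'a :: comm_ring_1"
  shows "fps_deriv (\<Prod>n<N. 1 + fps_const (y n) * fps_X) =
     (\<Prod>n<N. 1 + fps_const (y n) * fps_X) * Abs_fps (\<lambda>i. (- 1) ^ i * (\<Sum>n<N. y n ^ Suc i))"
proof (induction N)
  case 0
  then show ?case
    by (simp add: fps_zero_def[symmetric])
next
  case (Suc N)
  let ?E = "\<Prod>n<N. 1 + fps_const (y n) * fps_X" and ?c = "fps_const (y N)"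
  let ?L = "\<lambda>N. Abs_fps (\<lambda>i. (- 1) ^ i * (\<Sum>n<N. y n ^ Suc i))"
  let ?l = "Abs_fps (\<lambda>i. (- 1) ^ i * y N ^ Suc i)"
  have l: "(1 + ?c * fps_X) * ?l = ?c"
  proof (rule fps_ext)
    show "fps_nth ((1 + ?c * fps_X) * ?l) i = fps_nth ?c i" for i
      by (cases i) (simp_all add: distrib_right mult.assoc)
  qed
  have "?L (Suc N) = ?L N + ?l"
    by (rule fps_ext) (simp add: distrib_left)
  then have "(?E * (1 + ?c * fps_X)) * ?L (Suc N) = ?E * ?L N * (1 + ?c * fps_X) + ?E * ((1 + ?c * fps_X) * ?l)"
    by (simp only: distrib_left mult_ac)
  also have "\<dots> = fps_deriv (?E * (1 + ?c * fps_X))"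
    unfolding l Suc[symmetric] by (simp add: algebra_simps)
  finally show ?case
    by simp
qed

text \<open>Without the ordering, the tuples form an \<open>a\<close>-fold product set, where
  summability follows by induction; the ordered tuples are a subset.\<close>

lemma tuple_products_summable:
  fixes y :: "nat \<Rightarrow> complex"
  assumes "y summable_on {1..}"
  shows "(\<lambda>ns. prod_list (map y ns)) summable_on index_tuples a"
proof (rule summable_on_subset)
  show "index_tuples a \<subseteq> {ns. length ns = a \<and> set ns \<subseteq> {1..}}"
    by (auto simp: index_tuples_def)
  show "(\<lambda>ns. prod_list (map y ns)) summable_on {ns. length ns = a \<and> set ns \<subseteq> {1..}}"
  proof (induction a)
    case 0
    have "{ns. length ns = 0 \<and> set ns \<subseteq> {1..}} = {[] :: nat list}"
      by auto
    then show ?case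
      by simp
  next
    case (Suc a)
    have "(\<lambda>(n, ns). y n * prod_list (map y ns)) summable_on
        {1..} \<times> {ns. length ns = a \<and> set ns \<subseteq> {1..}}"
      using has_sum_Times_complex[OF has_sum_infsum[OF assms] has_sum_infsum[OF Suc]]
      by (rule has_sum_imp_summable)
    then show ?case
      by (rule iffD2[OF summable_on_reindex_bij_witness
            [where i = "\<lambda>(n, ns). n # ns" and j = "\<lambda>ns. (hd ns, tl ns)"], rotated -1])
         (auto simp: length_Suc_conv)
  qed
qed

text \<open>The logarithmic derivative gives Newton's identity for each finite product; then N tends
  to infinity termwise.\<close>

lemma newton_identity_tuples:
  fixes y :: "nat \<Rightarrow> complex"
  defines "e \<equiv> \<lambda>a. \<Sum>\<^sub>\<infinity>ns\<in>index_tuples a. prod_list (map y ns)"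
  assumes y: "y summable_on {1..}" and p: "\<And>i. (\<lambda>n. y (Suc n) ^ Suc i) sums p i"
  shows "of_nat (Suc a) * e (Suc a) = (\<Sum>i\<le>a. e i * ((- 1) ^ (a - i) * p (a - i)))"
proof -
  define E where "E N = (\<Prod>n<N. 1 + fps_const (y (Suc n)) * fps_X)" for N
  have lim: "(\<lambda>N. fps_nth (E N) a) \<longlonglongrightarrow> e a" for a
  proof -
    \<comment> \<open>The truncations eventually contain every finite set of tuples, so the
      truncated sums tend to the unconditional sum.\<close>
    have "filterlim (\<lambda>N. bounded_tuples a N) (finite_subsets_at_top (index_tuples a)) sequentially"
      unfolding filterlim_finite_subsets_at_top
    proof (intro allI impI)
      fix X :: "nat list set" assume X: "finite X \<and> X \<subseteq> index_tuples a"
      \<comment> \<open>Inserting 0 keeps \<open>Max\<close> meaningful when no entry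
        occurs.\<close>
      have "X \<subseteq> bounded_tuples a N" if "Max (insert 0 (\<Union>(set ` X))) \<le> N" for N
        using that X by (fastforce simp: bounded_tuples_def)
      moreover have "bounded_tuples a N \<subseteq> index_tuples a" for N
        by (auto simp: bounded_tuples_def)
      ultimately show "eventually (\<lambda>N. finite (bounded_tuples a N) \<and> X \<subseteq> bounded_tuples a N \<and>
          bounded_tuples a N \<subseteq> index_tuples a) sequentially"
        using finite_bounded_tuples
        by (intro eventually_sequentiallyI[of "Max (insert 0 (\<Union>(set ` X)))"]) blast
    qed
    then show ?thesis
      using filterlim_compose[OF infsum_tendsto[OF tuple_products_summable[OF y]]]
      unfolding E_def fps_nth_prod_linear e_def by blast
  qed
  have newton: "of_nat (Suc a) * fps_nth (E N) (Suc a) =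
      (\<Sum>i\<le>a. fps_nth (E N) i * ((- 1) ^ (a - i) * (\<Sum>n<N. y (Suc n) ^ Suc (a - i))))" for N
  proof -
    have "fps_nth (fps_deriv (E N)) a = of_nat (Suc a) * fps_nth (E N) (Suc a)"
      by simp
    then show ?thesis
      using fps_deriv_prod_linear[of "\<lambda>n. y (Suc n)" N]
      unfolding E_def by (simp only: fps_mult_nth atLeast0AtMost fps_nth_Abs_fps)
  qed
  have "(\<lambda>N. of_nat (Suc a) * fps_nth (E N) (Suc a)) \<longlonglongrightarrow>
      (\<Sum>i\<le>a. e i * ((- 1) ^ (a - i) * p (a - i)))"
    unfolding newton by (intro tendsto_intros lim p[unfolded sums_def])
  moreover have "(\<lambda>N. of_nat (Suc a) * fps_nth (E N) (Suc a)) \<longlonglongrightarrow> of_nat (Suc a) * e (Suc a)"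
    by (intro tendsto_intros lim)
  ultimately show ?thesis
    by (rule LIMSEQ_unique[symmetric])
qed

section \<open>Eisenstein series and quasimodularity\<close>

text \<open>Applying (t d/dt)^2 to the series of m t^m produces m^3 and then m^5, and it preserves
  polynomials in \<open>koebe t\<close>. Summed over t = q^n, this ties divisor sums to P_1, P_2,
  P_3.\<close>

lemma
  assumes "norm t < 1"
  shows koebe_lambert_1:
      "((\<lambda>m. of_nat (Suc m) ^ 1 * t ^ Suc m) has_sum koebe t) UNIV"
    and koebe_lambert_3:
      "((\<lambda>m. of_nat (Suc m) ^ 3 * t ^ Suc m) has_sum (koebe t + 6 * koebe t ^ 2)) UNIV"
    and koebe_lambert_5:
      "((\<lambda>m. of_nat (Suc m) ^ 5 * t ^ Suc m) has_sum (koebe t + 30 * koebe t ^ 2 + 120 * koebe t ^ 3)) UNIV"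
proof -
  define d where "d = 1 / (1 - t)"
  have "t \<noteq> 1"
    using assms by auto
  then have td: "t * d = d - 1"
    by (simp add: d_def field_simps)
  have k: "koebe t = t * d ^ 2"
    by (simp add: koebe_def d_def power_divide)
  have *: "((\<lambda>m. of_nat (Suc m) ^ k * t ^ Suc m) has_sum s) UNIV"
    if "\<And>j. of_nat (Suc j) ^ k = (\<Sum>i\<le>5. b i * pochhammer (of_nat j + 1 :: complex) i)"
      and "s = t * (b 0 * d + b 1 * d ^ 2 + 2 * b 2 * d ^ 3 + 6 * b 3 * d ^ 4 + 24 * b 4 * d ^ 5 + 120 * b 5 * d ^ 6)"
    for k s and b :: "nat \<Rightarrow> complex"
  proof -
    have "(\<Sum>i\<le>5. b i * (fact i / (1 - t) ^ Suc i)) =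
        b 0 * d + b 1 * d ^ 2 + 2 * b 2 * d ^ 3 + 6 * b 3 * d ^ 4 + 24 * b 4 * d ^ 5 + 120 * b 5 * d ^ 6"
      by (simp add: d_def fact_numeral eval_nat_numeral mult.commute)
    then show ?thesis
      using has_sum_cmult_right[OF has_sum_pochhammer_combination[OF assms that(1)], of t] that(2)
      by (simp add: mult_ac)
  qed
  show "((\<lambda>m. of_nat (Suc m) ^ 1 * t ^ Suc m) has_sum koebe t) UNIV"
    by (rule *[where b = "\<lambda>i. if i = 1 then 1 else 0"]) (simp_all add: k eval_nat_numeral)
  show "((\<lambda>m. of_nat (Suc m) ^ 3 * t ^ Suc m) has_sum (koebe t + 6 * koebe t ^ 2)) UNIV"
  \<comment> \<open>Signed Stirling numbers of the second kind: the coordinates of x^3 in rising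
    factorials of x = j + 1.\<close>
  proof (rule *[where b = "(!) [0, 1, - 3, 1, 0, 0]"])
    show "koebe t + 6 * koebe t ^ 2 = t * ([0, 1, - 3, 1, 0, 0] ! 0 * d + [0, 1, - 3, 1, 0, 0] ! 1 * d ^ 2
       + 2 * [0, 1, - 3, 1, 0, 0] ! 2 * d ^ 3 + 6 * [0, 1, - 3, 1, 0, 0] ! 3 * d ^ 4
       + 24 * [0, 1, - 3, 1, 0, 0] ! 4 * d ^ 5 + 120 * [0, 1, - 3, 1, 0, 0] ! 5 * d ^ 6)"
      unfolding k using td by simp algebra
  qed (simp add: eval_nat_numeral pochhammer_Suc algebra_simps)
  show "((\<lambda>m. of_nat (Suc m) ^ 5 * t ^ Suc m) has_sum (koebe t + 30 * koebe t ^ 2 + 120 * koebe t ^ 3)) UNIV"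
  \<comment> \<open>The same for x^5.\<close>
  proof (rule *[where b = "(!) [0, 1, - 15, 25, - 10, 1]"])
    show "koebe t + 30 * koebe t ^ 2 + 120 * koebe t ^ 3 = t * ([0, 1, - 15, 25, - 10, 1] ! 0 * d
       + [0, 1, - 15, 25, - 10, 1] ! 1 * d ^ 2
       + 2 * [0, 1, - 15, 25, - 10, 1] ! 2 * d ^ 3 + 6 * [0, 1, - 15, 25, - 10, 1] ! 3 * d ^ 4
       + 24 * [0, 1, - 15, 25, - 10, 1] ! 4 * d ^ 5 + 120 * [0, 1, - 15, 25, - 10, 1] ! 5 * d ^ 6)"
      unfolding k using td by simp algebra
  qed (simp add: eval_nat_numeral pochhammer_Suc algebra_simps)
qed

text \<open>Lambert series: the double sum of m^k q^(n m) is regrouped by the product N = n m, so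
  that m runs through the divisors of N.\<close>

lemma has_sum_divisor_sigma:
  fixes q :: complex
  assumes q: "norm q < 1"
    and L: "\<And>t. norm t < 1 \<Longrightarrow> ((\<lambda>m. of_nat (Suc m) ^ k * t ^ Suc m) has_sum L t) UNIV"
    and s: "((\<lambda>n. L (q ^ Suc n)) has_sum s) UNIV"
  shows "((\<lambda>N. of_nat (divisor_sigma k (Suc N)) * q ^ Suc N) has_sum s) UNIV"
proof -
  define f where "f = (\<lambda>(n, m). of_nat (Suc m) ^ k * (q ^ Suc n) ^ Suc m)"
  have "(\<lambda>n. q ^ n) summable_on UNIV"
    using q by (intro norm_summable_imp_summable_on) (simp add: norm_power summable_geometric)
  then have "(\<lambda>(n, m). q ^ n * (of_nat (Suc m) ^ k * q ^ Suc m)) summable_on UNIV \<times> UNIV"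
    using has_sum_Times_complex[OF has_sum_infsum L[OF q]] by (blast intro: has_sum_imp_summable)
  then have "(\<lambda>p. norm (case p of (n, m) \<Rightarrow> q ^ n * (of_nat (Suc m) ^ k * q ^ Suc m))) summable_on UNIV \<times> UNIV"
    by (simp only: summable_on_iff_abs_summable_on_complex)
  then have "(\<lambda>p. norm (f p)) summable_on UNIV \<times> UNIV"
  proof (rule Infinite_Sum.abs_summable_on_comparison_test)
    fix p :: "nat \<times> nat"
    obtain n m where p: "p = (n, m)"
      by fastforce
    \<comment> \<open>Since (n + 1) (m + 1) \<ge> n + (m + 1), the double series is dominated by a
      product of two convergent series.\<close>
    have "norm q ^ (Suc n * Suc m) \<le> norm q ^ (n + Suc m)"
      using q by (intro power_decreasing) auto
    then have "real (Suc m) ^ k * norm q ^ (Suc n * Suc m) \<le> real (Suc m) ^ k * norm q ^ (n + Suc m)"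
      by (intro mult_left_mono) auto
    then show "norm (f p) \<le> norm (case p of (n, m) \<Rightarrow> q ^ n * (of_nat (Suc m) ^ k * q ^ Suc m))"
      by (simp only: p f_def prod.case norm_mult norm_power norm_of_nat power_add mult_ac
          flip: power_mult)
  qed
  then have "f summable_on UNIV \<times> UNIV"
    by (simp only: summable_on_iff_abs_summable_on_complex)
  then have f: "(f has_sum s) (UNIV \<times> UNIV)"
  proof (rule has_sum_SigmaI[OF _ s, rotated])
    show "((\<lambda>m. f (n, m)) has_sum L (q ^ Suc n)) UNIV" for n
    proof -
      have "norm (q ^ Suc n) \<le> norm q ^ 1"
        unfolding norm_power using q by (intro power_decreasing) auto
      then show ?thesis
        using L[of "q ^ Suc n"] q unfolding f_def by (simp only: prod.case power_one_right)
    qed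
  qed
  define g where "g = (\<lambda>(N, d). of_nat d ^ k * q ^ Suc N)"
  have "(f has_sum s) (UNIV \<times> UNIV) = (g has_sum s) (SIGMA N:UNIV. {d. d dvd Suc N})"
  \<comment> \<open>All indices are shifted by one: the pair encodes the factorization of
    \<open>Suc N\<close> as \<open>Suc n * Suc m\<close>, with divisor
    \<open>d = Suc m\<close>.\<close>
  proof (rule has_sum_reindex_bij_witness[where j = "\<lambda>(n, m). (Suc n * Suc m - 1, Suc m)"
        and i = "\<lambda>(N, d). (Suc N div d - 1, d - 1)"], goal_cases)
    case (1 p)
    then show ?case
      by (auto simp del: mult_Suc mult_Suc_right split: prod.split)
  next
    case (2 p)
    then show ?case
      by (auto simp del: mult_Suc mult_Suc_right split: prod.split)
  next
    case (3 p)
    then obtain N d where "p = (N, d)" "d dvd Suc N"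
      by auto
    then obtain e where p: "p = (N, d)" "Suc N = d * e"
      by (auto simp: dvd_def)
    then have "d > 0" "e > 0"
      by (cases d; cases e; simp)+
    then have "Suc N div d = e" "Suc (e - 1) * Suc (d - 1) - 1 = N"
      using p(2) by (auto simp: mult.commute simp del: mult_Suc mult_Suc_right)
    then show ?case
      using p(1) \<open>d > 0\<close> by (simp del: mult_Suc mult_Suc_right)
  next
    case (5 p)
    obtain n m where p: "p = (n, m)"
      by (cases p)
    have "Suc (Suc n * Suc m - 1) = Suc n * Suc m"
      by simp
    then show ?case
      by (simp only: p f_def g_def prod.case power_mult)
  qed auto
  with f have "(g has_sum s) (SIGMA N:UNIV. {d. d dvd Suc N})"
    by simp
  then show ?thesis
  proof (rule has_sum_SigmaD)
    show "((\<lambda>d. g (N, d)) has_sum of_nat (divisor_sigma k (Suc N)) * q ^ Suc N) {d. d dvd Suc N}" for N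
      by (intro has_sum_finiteI) (simp_all add: g_def divisor_sigma_def sum_distrib_right)
  qed
qed

text \<open>An inductive form of weighted degree at most \<open>W\<close>: closure under sums and
  products follows by rule induction, without handling coefficient families. Only values on the
  upper half-plane are compared.\<close>

inductive eisenstein_poly :: "nat \<Rightarrow> (complex \<Rightarrow> complex) \<Rightarrow> bool" for W :: nat where
  monomial: "2 * i + 4 * j + 6 * l \<le> W \<Longrightarrow>
    (\<And>\<tau>. Im \<tau> > 0 \<Longrightarrow> f \<tau> = c * Eisenstein_E 2 \<tau> ^ i * Eisenstein_E 4 \<tau> ^ j * Eisenstein_E 6 \<tau> ^ l) \<Longrightarrow>
    eisenstein_poly W f"
| add: "eisenstein_poly W f \<Longrightarrow> eisenstein_poly W g \<Longrightarrow>
    (\<And>\<tau>. Im \<tau> > 0 \<Longrightarrow> h \<tau> = f \<tau> + g \<tau>) \<Longrightarrow> eisenstein_poly W h"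

section \<open>Closure properties and the passage to mixed weight\<close>

lemma eisenstein_poly_const: "eisenstein_poly W (\<lambda>_. c)"
  by (rule eisenstein_poly.monomial[of 0 0 0 _ _ c]) auto

lemma eisenstein_poly_cong:
  assumes "eisenstein_poly W f" and "\<And>\<tau>. Im \<tau> > 0 \<Longrightarrow> g \<tau> = f \<tau>"
  shows "eisenstein_poly W g"
  by (rule eisenstein_poly.add[OF assms(1) eisenstein_poly_const[of W 0]]) (use assms(2) in simp)

lemma eisenstein_poly_add:
  "eisenstein_poly W f \<Longrightarrow> eisenstein_poly W g \<Longrightarrow> eisenstein_poly W (\<lambda>\<tau>. f \<tau> + g \<tau>)"
  by (rule eisenstein_poly.add) (assumption | rule refl)+

lemma eisenstein_poly_mono:
  assumes "eisenstein_poly W f" and "W \<le> W'"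
  shows "eisenstein_poly W' f"
  using assms
proof (induction rule: eisenstein_poly.induct)
  case (monomial i j l f c)
  then show ?case
    by (intro eisenstein_poly.monomial[of i j l W' f c]) auto
next
  case (add f g h)
  show ?case
    by (rule eisenstein_poly.add[OF add.IH]) (simp_all add: add)
qed

lemma eisenstein_poly_mult:
  assumes "eisenstein_poly W f" and "eisenstein_poly W' g"
  shows "eisenstein_poly (W + W') (\<lambda>\<tau>. f \<tau> * g \<tau>)"
  using assms(1)
proof (induction rule: eisenstein_poly.induct)
  case f: (monomial i j l f c)
  from assms(2) show ?case
  proof (induction rule: eisenstein_poly.induct)
    case (monomial i' j' l' g c')
    then show ?case
      using f by (intro eisenstein_poly.monomial[of "i + i'" "j + j'" "l + l'" _ _ "c * c'"])
        (auto simp: power_add)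
  next
    case (add g g' h)
    show ?case
      by (rule eisenstein_poly.add[OF add.IH]) (simp add: add.hyps distrib_left)
  qed
next
  case (add f f' h)
  show ?case
    by (rule eisenstein_poly.add[OF add.IH]) (simp add: add.hyps distrib_right)
qed

lemma eisenstein_poly_cmult:
  "eisenstein_poly W f \<Longrightarrow> eisenstein_poly W (\<lambda>\<tau>. c * f \<tau>)"
  using eisenstein_poly_mult[OF eisenstein_poly_const[of 0 c], of W f] by (simp only: add_0)

lemma eisenstein_poly_diff:
  "eisenstein_poly W f \<Longrightarrow> eisenstein_poly W g \<Longrightarrow> eisenstein_poly W (\<lambda>\<tau>. f \<tau> - g \<tau>)"
  using eisenstein_poly_add[OF _ eisenstein_poly_cmult[of W g "- 1"], of f]
  by (simp only: mult_minus1 add_uminus_conv_diff)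

lemma eisenstein_poly_sum:
  fixes N :: nat
  assumes "\<And>i. i \<le> N \<Longrightarrow> eisenstein_poly W (f i)"
  shows "eisenstein_poly W (\<lambda>\<tau>. \<Sum>i\<le>N. f i \<tau>)"
  using assms
proof (induction N)
  case (Suc N)
  show ?case
    unfolding sum.atMost_Suc by (rule eisenstein_poly_add) (simp_all add: Suc)
qed simp

text \<open>A monomial is a form of its own weight, with coefficients supported at one exponent; for
  a sum, the two finite families are concatenated.\<close>

lemma eisenstein_poly_imp_mixed_quasimodular:
  "eisenstein_poly W f \<Longrightarrow> mixed_quasimodular_form W f"
proof (induction rule: eisenstein_poly.induct)
  case (monomial i j l f c)
  have "quasimodular_form (2 * i + 4 * j + 6 * l) f"
    unfolding quasimodular_form_def
  proof (intro exI[of _ "\<lambda>i' j' l'. of_bool ((i', j', l') = (i, j, l)) * c"] allI impI)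
    fix \<tau> :: complex assume "Im \<tau> > 0"
    let ?m = "\<lambda>(i', j', l'). of_bool ((i', j', l') = (i, j, l)) * c *
        Eisenstein_E 2 \<tau> ^ i' * Eisenstein_E 4 \<tau> ^ j' * Eisenstein_E 6 \<tau> ^ l'"
    have "sum ?m (weight_exponents (2 * i + 4 * j + 6 * l)) = sum ?m {(i, j, l)}"
      by (intro sum.mono_neutral_right finite_weight_exponents) (auto simp: weight_exponents_def)
    then show "f \<tau> = sum ?m (weight_exponents (2 * i + 4 * j + 6 * l))"
      using monomial(2)[OF \<open>Im \<tau> > 0\<close>] by simp
  qed
  then show ?case
    unfolding mixed_quasimodular_form_def using monomial(1)
    by (intro exI[of _ 1] exI[of _ "\<lambda>_. 2 * i + 4 * j + 6 * l"] exI[of _ "\<lambda>_. f"]) auto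
next
  case (add f g h)
  obtain N1 :: nat and w1 F1 where 1: "\<forall>i<N1. w1 i \<le> W \<and> quasimodular_form (w1 i) (F1 i)"
      "\<forall>\<tau>. Im \<tau> > 0 \<longrightarrow> f \<tau> = (\<Sum>i<N1. F1 i \<tau>)"
    using add.IH(1) unfolding mixed_quasimodular_form_def by blast
  obtain N2 :: nat and w2 F2 where 2: "\<forall>i<N2. w2 i \<le> W \<and> quasimodular_form (w2 i) (F2 i)"
      "\<forall>\<tau>. Im \<tau> > 0 \<longrightarrow> g \<tau> = (\<Sum>i<N2. F2 i \<tau>)"
    using add.IH(2) unfolding mixed_quasimodular_form_def by blast
  define w F where "w i = (if i < N1 then w1 i else w2 (i - N1))"
    and "F i = (if i < N1 then F1 i else F2 (i - N1))" for i
  have "(\<Sum>i<N1 + M. F i \<tau>) = (\<Sum>i<N1. F1 i \<tau>) + (\<Sum>i<M. F2 i \<tau>)" for M \<tau>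
    by (induction M) (auto simp: F_def)
  then show ?case
    unfolding mixed_quasimodular_form_def using 1 2 add.hyps
    by (intro exI[of _ "N1 + N2"] exI[of _ w] exI[of _ F]) (auto simp: w_def F_def)
qed

section \<open>Power sums as polynomials in E_2, E_4, E_6\<close>

lemma punctured_disc_nome:
  assumes "Im \<tau> > 0"
  shows "punctured_disc (nome \<tau>)"
  using assms by unfold_locales (auto simp: nome_def)

lemma (in punctured_disc) koebe_power_sum_divisor_sigma:
  shows "((\<lambda>N. of_nat (divisor_sigma 1 (Suc N)) * q ^ Suc N) has_sum koebe_power_sum 1) UNIV"
    and "((\<lambda>N. of_nat (divisor_sigma 3 (Suc N)) * q ^ Suc N) has_sum
      (koebe_power_sum 1 + 6 * koebe_power_sum 2)) UNIV"
    and "((\<lambda>N. of_nat (divisor_sigma 5 (Suc N)) * q ^ Suc N) has_sum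
      (koebe_power_sum 1 + 30 * koebe_power_sum 2 + 120 * koebe_power_sum 3)) UNIV"
proof -
  have k1: "((\<lambda>n. koebe (q ^ Suc n)) has_sum koebe_power_sum 1) UNIV"
    using koebe_power_sum_has_sum[of 1] by (simp only: power_one_right le_refl)
  show "((\<lambda>N. of_nat (divisor_sigma 1 (Suc N)) * q ^ Suc N) has_sum koebe_power_sum 1) UNIV"
    by (rule has_sum_divisor_sigma[OF norm_q koebe_lambert_1 k1])
  show "((\<lambda>N. of_nat (divisor_sigma 3 (Suc N)) * q ^ Suc N) has_sum
      (koebe_power_sum 1 + 6 * koebe_power_sum 2)) UNIV"
    by (rule has_sum_divisor_sigma[OF norm_q koebe_lambert_3])
       (assumption, intro has_sum_add has_sum_cmult_right koebe_power_sum_has_sum k1, simp)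
  show "((\<lambda>N. of_nat (divisor_sigma 5 (Suc N)) * q ^ Suc N) has_sum
      (koebe_power_sum 1 + 30 * koebe_power_sum 2 + 120 * koebe_power_sum 3)) UNIV"
    by (rule has_sum_divisor_sigma[OF norm_q koebe_lambert_5])
       (assumption, intro has_sum_add has_sum_cmult_right koebe_power_sum_has_sum k1, simp_all)
qed

text \<open>The factors 2 k / B_k are 24, -240 and 504.\<close>

lemma
  assumes "Im \<tau> > 0"
  defines "K \<equiv> punctured_disc.koebe_power_sum (nome \<tau>)"
  shows Eisenstein_E_2: "Eisenstein_E 2 \<tau> = 1 - 24 * K 1"
    and Eisenstein_E_4: "Eisenstein_E 4 \<tau> = 1 + 240 * (K 1 + 6 * K 2)"
    and Eisenstein_E_6: "Eisenstein_E 6 \<tau> = 1 - 504 * (K 1 + 30 * K 2 + 120 * K 3)"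
proof -
  interpret punctured_disc "nome \<tau>"
    by (rule punctured_disc_nome) fact
  note S = koebe_power_sum_divisor_sigma[THEN has_sum_imp_sums, THEN sums_unique, symmetric]
  show "Eisenstein_E 2 \<tau> = 1 - 24 * K 1"
    unfolding Eisenstein_E_def K_def bernoulli_2 using S(1) by simp
  show "Eisenstein_E 4 \<tau> = 1 + 240 * (K 1 + 6 * K 2)"
    unfolding Eisenstein_E_def K_def bernoulli_4 using S(2) by simp
  show "Eisenstein_E 6 \<tau> = 1 - 504 * (K 1 + 30 * K 2 + 120 * K 3)"
    unfolding Eisenstein_E_def K_def bernoulli_6 using S(3) by simp
qed

text \<open>The two claims are proved jointly. For j \<le> 2 an Eisenstein series gives the power
  sum, and this the coefficient; from 3 on the recurrence gives the coefficient, and this the power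
  sum.\<close>

lemma eisenstein_poly_koebe_coeff:
  "eisenstein_poly (2 * j + 2) (\<lambda>\<tau>. punctured_disc.koebe_coeff (nome \<tau>) j) \<and>
   eisenstein_poly (2 * j + 2) (\<lambda>\<tau>. punctured_disc.koebe_power_sum (nome \<tau>) (Suc j))"
proof (induction j rule: less_induct)
  case (less j)
  define h where "h j \<tau> = punctured_disc.koebe_coeff (nome \<tau>) j" for j \<tau>
  define K where "K s \<tau> = punctured_disc.koebe_power_sum (nome \<tau>) s" for s \<tau>
  have IHh: "eisenstein_poly (2 * i + 2) (h i)" and IHK: "eisenstein_poly (2 * i + 2) (K (Suc i))" if "i < j" for i
    using less[OF that] by (simp_all add: h_def[abs_def] K_def[abs_def])
  have hK: "h i \<tau> = of_nat i * K i \<tau> + (4 * of_nat i + 2) * K (Suc i) \<tau>" if "Im \<tau> > 0" for i \<tau>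
    unfolding h_def K_def by (rule punctured_disc.koebe_coeff_def[OF punctured_disc_nome[OF that]])
  have K_prev: "eisenstein_poly (2 * j + 2) (\<lambda>\<tau>. of_nat j * K j \<tau>)"
  \<comment> \<open>At 0 the factor \<open>of_nat j\<close> makes the function 0; the induction
    hypothesis covers only \<open>K (Suc i)\<close>.\<close>
  proof (cases j)
    case 0
    then show ?thesis
      by (simp add: eisenstein_poly_const)
  next
    case (Suc i)
    then show ?thesis
      by (intro eisenstein_poly_cmult eisenstein_poly_mono[OF IHK[of i, folded Suc]]) auto
  qed
  have E2: "eisenstein_poly 2 (Eisenstein_E 2)"
    by (rule eisenstein_poly.monomial[of 1 0 0 _ _ 1]) auto
  have E4: "eisenstein_poly 4 (Eisenstein_E 4)"
    by (rule eisenstein_poly.monomial[of 0 1 0 _ _ 1]) auto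
  have E6: "eisenstein_poly 6 (Eisenstein_E 6)"
    by (rule eisenstein_poly.monomial[of 0 0 1 _ _ 1]) auto
  have K_step: "eisenstein_poly (2 * j + 2) (K (Suc j))" if "j \<le> 2"
  proof -
    have K1: "eisenstein_poly W (K 1)" if "j > 0" "W \<ge> 2" for W
      using eisenstein_poly_mono[OF IHK[of 0]] that by simp
    have K2: "eisenstein_poly 6 (K 2)" if "j > 1"
      using eisenstein_poly_mono[OF IHK[OF that], of 6] by (simp add: numeral_2_eq_2)
    have "j = 0 \<or> j = 1 \<or> j = 2"
      using that by linarith
    then consider "j = 0" | "j = 1" | "j = 2"
      by blast
    then show ?thesis
    proof cases
      case 1
      have "eisenstein_poly 2 (\<lambda>\<tau>. (1 / 24) * (1 - Eisenstein_E 2 \<tau>))"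
        by (intro eisenstein_poly_cmult eisenstein_poly_diff eisenstein_poly_const E2)
      then have "eisenstein_poly 2 (K 1)"
        by (rule eisenstein_poly_cong) (simp add: K_def Eisenstein_E_2)
      then show ?thesis
        using 1 by (simp add: numeral_2_eq_2)
    next
      case 2
      have "eisenstein_poly 4 (\<lambda>\<tau>. (1 / 6) * ((1 / 240) * (Eisenstein_E 4 \<tau> - 1) - K 1 \<tau>))"
        using K1[of 4] 2
        by (intro eisenstein_poly_cmult eisenstein_poly_diff eisenstein_poly_const E4) simp
      then have "eisenstein_poly 4 (K 2)"
        by (rule eisenstein_poly_cong) (simp add: K_def Eisenstein_E_4 field_simps)
      then show ?thesis
        using 2 by (simp flip: numeral_2_eq_2)
    next
      case 3
      have "eisenstein_poly 6 (\<lambda>\<tau>. (1 / 120) * ((1 / 504) * (1 - Eisenstein_E 6 \<tau>) - K 1 \<tau> - 30 * K 2 \<tau>))"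
        using K1[of 6] K2 3
        by (intro eisenstein_poly_cmult eisenstein_poly_diff eisenstein_poly_const E6) simp_all
      then have "eisenstein_poly 6 (K 3)"
        by (rule eisenstein_poly_cong) (simp add: K_def Eisenstein_E_6 field_simps)
      then show ?thesis
        using 3 by (simp add: eval_nat_numeral)
    qed
  qed
  show ?case
    unfolding h_def[symmetric, abs_def] K_def[symmetric, abs_def]
  proof (cases "j \<le> 2")
    case True
    have "eisenstein_poly (2 * j + 2) (\<lambda>\<tau>. of_nat j * K j \<tau> + (4 * of_nat j + 2) * K (Suc j) \<tau>)"
      by (intro eisenstein_poly_add K_prev eisenstein_poly_cmult K_step True)
    then have "eisenstein_poly (2 * j + 2) (h j)"
      by (rule eisenstein_poly_cong) (rule hK)
    with K_step[OF True] show "eisenstein_poly (2 * j + 2) (h j) \<and> eisenstein_poly (2 * j + 2) (K (Suc j))"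
      by blast
  next
    case False
    then obtain i where i: "j = Suc i" "i \<ge> 2"
      by (cases j) auto
    \<comment> \<open>The factor of \<open>h j\<close> in 6 times the recurrence at
      \<open>i\<close>. It would vanish at i = 1, which is why P_3 is taken from E_6; for i \<ge> 2
      the subtracted product is at least 30.\<close>
    define D :: complex where "D = 12 - (4 * of_nat i + 2) * (of_nat i + 1)"
    have "(4 * i + 2) * (i + 1) \<ge> 10 * 3"
      using i by (intro mult_mono) auto
    then have "(of_nat ((4 * i + 2) * (i + 1)) :: complex) \<noteq> of_nat 12"
      unfolding of_nat_eq_iff by linarith
    moreover have "D = of_nat 12 - of_nat ((4 * i + 2) * (i + 1))"
      by (simp add: D_def algebra_simps)
    ultimately have "D \<noteq> 0"
      by (simp only: right_minus_eq)
    \<comment> \<open>The weights fit exactly: 2 l + 2 + 2 m + 2 = 2 j + 2, as j = l + m +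
      1.\<close>
    have h_mult: "eisenstein_poly (2 * j + 2) (\<lambda>\<tau>. h l \<tau> * h m \<tau>)" if "l + m = i" for l m
    proof -
      have "l < j" "m < j" "2 * l + 2 + (2 * m + 2) \<le> 2 * j + 2"
        using that i by linarith+
      then show ?thesis
        by (blast intro: eisenstein_poly_mono[OF eisenstein_poly_mult[OF IHh IHh]])
    qed
    have h_i: "eisenstein_poly (2 * j + 2) (h i)"
      by (rule eisenstein_poly_mono[OF IHh]) (use i in linarith)+
    have h_sum: "eisenstein_poly (2 * j + 2) (\<lambda>\<tau>. \<Sum>l\<le>i. h l \<tau> * h (i - l) \<tau>)"
      by (rule eisenstein_poly_sum[where f = "\<lambda>l \<tau>. h l \<tau> * h (i - l) \<tau>"]) (rule h_mult, simp)
    have "eisenstein_poly (2 * j + 2) (\<lambda>\<tau>. (1 / D) * (((of_nat i)\<^sup>2 - 1) * h i \<tau> + 12 * (h 0 \<tau> * h i \<tau>)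
        - 6 * (\<Sum>l\<le>i. h l \<tau> * h (i - l) \<tau>)))"
      by (intro eisenstein_poly_cmult eisenstein_poly_diff eisenstein_poly_add h_i h_sum h_mult) simp
    then have h: "eisenstein_poly (2 * j + 2) (h j)"
    proof (rule eisenstein_poly_cong)
      fix \<tau> :: complex assume "Im \<tau> > 0"
      then interpret punctured_disc "nome \<tau>"
        by (rule punctured_disc_nome)
      have "6 * (2 * h (Suc i) \<tau> + (\<Sum>l\<le>i. h l \<tau> * h (i - l) \<tau>)) =
          6 * (euler_coeff (\<lambda>j. h j \<tau>) i + 2 * h 0 \<tau> * h i \<tau>)"
        using koebe_coeff_recurrence[of i] i by (simp add: h_def)
      moreover have "6 * euler_coeff (\<lambda>j. h j \<tau>) i =
          ((of_nat i)\<^sup>2 - 1) * h i \<tau> + (4 * of_nat i + 2) * (of_nat i + 1) * h (Suc i) \<tau>"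
        by (simp add: euler_coeff_def)
      ultimately have "D * h j \<tau> = ((of_nat i)\<^sup>2 - 1) * h i \<tau> + 12 * (h 0 \<tau> * h i \<tau>)
          - 6 * (\<Sum>l\<le>i. h l \<tau> * h (i - l) \<tau>)"
        unfolding D_def i(1) by algebra
      then show "h j \<tau> = (1 / D) * (((of_nat i)\<^sup>2 - 1) * h i \<tau> + 12 * (h 0 \<tau> * h i \<tau>)
          - 6 * (\<Sum>l\<le>i. h l \<tau> * h (i - l) \<tau>))"
        unfolding \<open>D * h j \<tau> = _\<close>[symmetric] using \<open>D \<noteq> 0\<close> by simp
    qed
    \<comment> \<open>The defining relation of \<open>koebe_coeff\<close>, solved for the next power
      sum.\<close>
    have "eisenstein_poly (2 * j + 2) (\<lambda>\<tau>. (1 / (4 * of_nat j + 2)) * (h j \<tau> - of_nat j * K j \<tau>))"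
      by (intro eisenstein_poly_cmult eisenstein_poly_diff h K_prev)
    then have "eisenstein_poly (2 * j + 2) (K (Suc j))"
    proof (rule eisenstein_poly_cong)
      have "of_nat (4 * j + 2) \<noteq> (0 :: complex)"
        unfolding of_nat_eq_0_iff by simp
      then have "4 * of_nat j + 2 \<noteq> (0 :: complex)"
        by (simp add: add.commute)
      then show "K (Suc j) \<tau> = (1 / (4 * of_nat j + 2)) * (h j \<tau> - of_nat j * K j \<tau>)" if "Im \<tau> > 0" for \<tau>
        by (simp add: hK[OF that])
    qed
    with h show "eisenstein_poly (2 * j + 2) (h j) \<and> eisenstein_poly (2 * j + 2) (K (Suc j))"
      by blast
  qed
qed

text \<open>The choice k = 2 r makes each factor the \<open>r\<close>-th power of
  \<open>koebe (q ^ n)\<close>.\<close>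

lemma A_series_eq_koebe_products:
  "A_series a (2 * int r) r q = (\<Sum>\<^sub>\<infinity>ns\<in>index_tuples a. prod_list (map (\<lambda>n. koebe (q ^ n) ^ r) ns))"
proof -
  have "q ^ (r * sum_list ns) / (\<Prod>n\<leftarrow>ns. (1 - q ^ n) powi (2 * int r)) = (\<Prod>n\<leftarrow>ns. koebe (q ^ n) ^ r)" for ns
  proof (induction ns)
    case (Cons n ns)
    have "(1 - q ^ n) powi (2 * int r) = ((1 - q ^ n)\<^sup>2) ^ r"
      by (simp add: power_int_def nat_mult_distrib power_mult)
    then have "koebe (q ^ n) ^ r = q ^ (r * n) / (1 - q ^ n) powi (2 * int r)"
      by (simp add: koebe_def power_divide mult.commute[of r] flip: power_mult)
    then show ?case
      by (simp add: distrib_left power_add flip: Cons)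
  qed simp
  then show ?thesis
    by (simp add: A_series_def)
qed

text \<open>In the variables \<open>koebe (q ^ n) ^ r\<close> the power sums are again of the form
  P_s, with s a multiple of \<open>r\<close>.\<close>

lemma (in punctured_disc) A_series_newton:
  assumes "r \<ge> 1"
  shows "of_nat (Suc a) * A_series (Suc a) (2 * int r) r q =
    (\<Sum>i\<le>a. A_series i (2 * int r) r q * ((- 1) ^ (a - i) * koebe_power_sum (r * Suc (a - i))))"
  unfolding A_series_eq_koebe_products
proof (rule newton_identity_tuples)
  have "((\<lambda>n. koebe (q ^ Suc n) ^ r) has_sum koebe_power_sum r) UNIV"
    by (rule koebe_power_sum_has_sum[OF assms])
  then have "((\<lambda>n. koebe (q ^ n) ^ r) has_sum koebe_power_sum r) {1..}"
    by (rule iffD1[OF has_sum_reindex_bij_witness[where i = "\<lambda>n. n - 1" and j = Suc], rotated -1]) auto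
  then show "(\<lambda>n. koebe (q ^ n) ^ r) summable_on {1..}"
    by (rule has_sum_imp_summable)
  show "(\<lambda>n. (koebe (q ^ Suc n) ^ r) ^ Suc i) sums koebe_power_sum (r * Suc i)" for i
    unfolding power_mult[symmetric]
    by (rule has_sum_imp_sums, rule koebe_power_sum_has_sum) (use assms in simp)
qed

text \<open>Induction on \<open>a\<close> by Newton's identity: the weights 2 i r of the earlier
  series and 2 r (a - i) of the power sum add up to 2 a r.\<close>

lemma eisenstein_poly_A_series:
  assumes "r \<ge> 1"
  shows "eisenstein_poly (2 * a * r) (\<lambda>\<tau>. A_series a (2 * int r) r (nome \<tau>))"
proof (induction a rule: less_induct)
  case (less a)
  show ?case
  proof (cases a)
    case 0
    have "index_tuples 0 = {[]}"
      by (auto simp: index_tuples_def)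
    then show ?thesis
      using 0 by (simp add: A_series_def eisenstein_poly_const)
  next
    case (Suc b)
    let ?P = "\<lambda>s \<tau>. punctured_disc.koebe_power_sum (nome \<tau>) s"
    have summand: "eisenstein_poly (2 * a * r)
        (\<lambda>\<tau>. (- 1) ^ (b - i) * (A_series i (2 * int r) r (nome \<tau>) * ?P (r * Suc (b - i)) \<tau>))"
      if "i \<le> b" for i
    proof -
      obtain s where s: "r * Suc (b - i) = Suc s"
        using assms by (cases "r * Suc (b - i)") auto
      have P: "eisenstein_poly (2 * (r * Suc (b - i))) (?P (r * Suc (b - i)))"
        using eisenstein_poly_koebe_coeff[of s] unfolding s by simp
      have "i + Suc (b - i) = a"
        using that Suc by linarith
      then have "(i + Suc (b - i)) * r = a * r"
        by (simp only:)
      then have weight: "2 * i * r + 2 * (r * Suc (b - i)) = 2 * a * r"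
        by (simp only: distrib_right mult.assoc mult.commute[of r] flip: distrib_left)
      have "i < a"
        using that Suc by linarith
      from eisenstein_poly_mult[OF less[OF this] P] show ?thesis
        unfolding weight by (rule eisenstein_poly_cmult)
    qed
    have "eisenstein_poly (2 * a * r) (\<lambda>\<tau>. (1 / of_nat (Suc b)) *
        (\<Sum>i\<le>b. (- 1) ^ (b - i) * (A_series i (2 * int r) r (nome \<tau>) * ?P (r * Suc (b - i)) \<tau>)))"
      by (rule eisenstein_poly_cmult, rule eisenstein_poly_sum, rule summand)
    then show ?thesis
    proof (rule eisenstein_poly_cong)
      fix \<tau> :: complex assume "Im \<tau> > 0"
      then interpret punctured_disc "nome \<tau>"
        by (rule punctured_disc_nome)
      have "A_series (Suc b) (2 * int r) r (nome \<tau>) = (1 / of_nat (Suc b)) *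
          (of_nat (Suc b) * A_series (Suc b) (2 * int r) r (nome \<tau>))"
        by (simp del: of_nat_Suc)
      then show "A_series a (2 * int r) r (nome \<tau>) = (1 / of_nat (Suc b)) *
        (\<Sum>i\<le>b. (- 1) ^ (b - i) * (A_series i (2 * int r) r (nome \<tau>) * koebe_power_sum (r * Suc (b - i))))"
        unfolding A_series_newton[OF assms] Suc by (simp only: mult_ac)
    qed
  qed
qed

theorem theorem1p5:
  fixes a r :: nat
  assumes "a \<ge> 1" and "r \<ge> 1"
  shows "mixed_quasimodular_form (2 * a * r) (\<lambda>\<tau>. A_series a (2 * int r) r (nome \<tau>))"
  by (rule eisenstein_poly_imp_mixed_quasimodular[OF eisenstein_poly_A_series[OF assms(2)]])

end
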